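(* Let $\mathcal{G}=\bigcup_{k=1}^{s}G_k$ be a graphical cake represented by a finite graph with $s$ connected components $G_1,\dots,G_s$, where $G_k$ has radius $r_k$, and let $r=\max_k r_k$. Let two agents $A,B$ have valuations $v_A,v_B$ on $\mathcal{G}$ and let $0\le t\le1$ with entitlement vector $(t,1-t)$. Then there exists a weighted consensus division $(\alpha,\beta)$ of $\mathcal{G}$ in which the total number of connected components of $\alpha$ plus that of $\beta$ is at most $s+2r+4$. More precisely, the division can be chosen so that either (i) $s-1$ of the components $G_k$ are each contained wholly in $\alpha$ or wholly in $\beta$, and the remaining component $G_i$ is divided so that $\alpha\cap G_i$ and $\beta\cap G_i$ each have at most $r+2$ connected components; or (ii) $s-2$ of the components $G_k$ are each contained wholly in $\alpha$ or wholly in $\beta$, and the remaining two components $G_i,G_j$ are divided so that $\alpha\cap(G_i\cup G_j)$ and $\beta\cap(G_i\cup G_j)$ each have at most $r+3$ connected components.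
   Context: A graphical cake represented by a finite graph (loops and multiple edges allowed) consists of one closed interval per edge, with endpoints identified according to the incidence structure of the graph. A piece is a finite union of subintervals of edges; its connected pieces are its path components under the endpoint identifications. The radius of a connected graph is $\min_v\max_w d(v,w)$ with $d$ the graph distance. A valuation is a non-atomic Borel probability measure on the cake. A division between two agents is a pair of pieces $(\alpha,\beta)$ with $\alpha\cup\beta=\mathcal{G}$ and $\alpha\cap\beta$ finite. Given entitlements $(t,1-t)$, $0\le t\le1$, a division is a weighted consensus division if $v_A(\alpha)=v_B(\alpha)=t$ and $v_A(\beta)=v_B(\beta)=1-t$. *)

theory Defs
  imports "HOL-Analysis.Analysis" "HOL-Probability.Probability"
begin

text \<open>A finite graph is given by a finite vertex set V, a finite edge set E and an
  incidence map ends : E -> V x V (an edge e joins fst (ends e) and snd (ends e);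
  loops: fst = snd; multiple edges: different e with equal ends).\<close>

definition graph_ok :: "'v set \<Rightarrow> 'e set \<Rightarrow> ('e \<Rightarrow> 'v \<times> 'v) \<Rightarrow> bool" where
  "graph_ok V E ends \<longleftrightarrow> finite V \<and> finite E \<and> (\<forall>e\<in>E. fst (ends e) \<in> V \<and> snd (ends e) \<in> V)"

definition adj :: "'e set \<Rightarrow> ('e \<Rightarrow> 'v \<times> 'v) \<Rightarrow> ('v \<times> 'v) set" where
  "adj E ends = {(v, w). \<exists>e\<in>E. ends e = (v, w) \<or> ends e = (w, v)}"

definition gdist :: "'e set \<Rightarrow> ('e \<Rightarrow> 'v \<times> 'v) \<Rightarrow> 'v \<Rightarrow> 'v \<Rightarrow> nat" where
  "gdist E ends v w = (LEAST n. (v, w) \<in> adj E ends ^^ n)"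

definition graph_components :: "'v set \<Rightarrow> 'e set \<Rightarrow> ('e \<Rightarrow> 'v \<times> 'v) \<Rightarrow> 'v set set" where
  "graph_components V E ends = V // {(v, w). v \<in> V \<and> w \<in> V \<and> (v, w) \<in> (adj E ends)\<^sup>*}"

definition comp_radius :: "'e set \<Rightarrow> ('e \<Rightarrow> 'v \<times> 'v) \<Rightarrow> 'v set \<Rightarrow> nat" where
  "comp_radius E ends C = Min ((\<lambda>v. Max ((\<lambda>w. gdist E ends v w) ` C)) ` C)"

text \<open>Points of the cake: a vertex, or an interior point x in (0,1) of an edge.
  Edge e is the interval [0,1] with 0 identified with fst (ends e) and 1 with snd (ends e).\<close>
datatype ('v, 'e) cpt = Vtx 'v | Inner 'e real

definition edge_pt :: "('e \<Rightarrow> 'v \<times> 'v) \<Rightarrow> 'e \<Rightarrow> real \<Rightarrow> ('v, 'e) cpt" where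
  "edge_pt ends e x = (if x = 0 then Vtx (fst (ends e)) else if x = 1 then Vtx (snd (ends e)) else Inner e x)"

definition cake :: "'e set \<Rightarrow> ('e \<Rightarrow> 'v \<times> 'v) \<Rightarrow> ('v, 'e) cpt set" where
  "cake E ends = (\<Union>e\<in>E. edge_pt ends e ` {0..1})"

text \<open>The quotient topology of the disjoint union of the edge intervals under the
  endpoint identifications.\<close>
definition cake_open :: "'e set \<Rightarrow> ('e \<Rightarrow> 'v \<times> 'v) \<Rightarrow> ('v, 'e) cpt set \<Rightarrow> bool" where
  "cake_open E ends U \<longleftrightarrow> U \<subseteq> cake E ends \<and>
     (\<forall>e\<in>E. open {x. 0 < x \<and> x < 1 \<and> Inner e x \<in> U}) \<and>
     (\<forall>v. Vtx v \<in> U \<longrightarrow> (\<exists>\<epsilon>>0. \<epsilon> < 1 \<and> (\<forall>e\<in>E.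
        (fst (ends e) = v \<longrightarrow> (\<forall>x. 0 < x \<and> x < \<epsilon> \<longrightarrow> Inner e x \<in> U)) \<and>
        (snd (ends e) = v \<longrightarrow> (\<forall>x. 1 - \<epsilon> < x \<and> x < 1 \<longrightarrow> Inner e x \<in> U)))))"

definition cake_top :: "'e set \<Rightarrow> ('e \<Rightarrow> 'v \<times> 'v) \<Rightarrow> ('v, 'e) cpt topology" where
  "cake_top E ends = topology (cake_open E ends)"

definition cake_borel :: "'e set \<Rightarrow> ('e \<Rightarrow> 'v \<times> 'v) \<Rightarrow> ('v, 'e) cpt set set" where
  "cake_borel E ends = sets (sigma (cake E ends) {U. openin (cake_top E ends) U})"

definition valuation :: "'e set \<Rightarrow> ('e \<Rightarrow> 'v \<times> 'v) \<Rightarrow> ('v, 'e) cpt measure \<Rightarrow> bool" where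
  "valuation E ends M \<longleftrightarrow> prob_space M \<and> space M = cake E ends \<and> sets M = cake_borel E ends \<and>
     (\<forall>x\<in>cake E ends. emeasure M {x} = 0)"

definition piece :: "'e set \<Rightarrow> ('e \<Rightarrow> 'v \<times> 'v) \<Rightarrow> ('v, 'e) cpt set \<Rightarrow> bool" where
  "piece E ends P \<longleftrightarrow> (\<exists>F. finite F \<and> (\<forall>(e, I)\<in>F. e \<in> E \<and> I \<subseteq> {0..1} \<and> is_interval I) \<and>
     P = (\<Union>(e, I)\<in>F. edge_pt ends e ` I))"

text \<open>Number of connected (= path-) components of a subset of the cake.\<close>
definition ncomp :: "'e set \<Rightarrow> ('e \<Rightarrow> 'v \<times> 'v) \<Rightarrow> ('v, 'e) cpt set \<Rightarrow> nat" where
  "ncomp E ends P = card (path_components_of (subtopology (cake_top E ends) P))"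

definition comp_cake :: "'e set \<Rightarrow> ('e \<Rightarrow> 'v \<times> 'v) \<Rightarrow> 'v set \<Rightarrow> ('v, 'e) cpt set" where
  "comp_cake E ends C = (\<Union>e\<in>{e\<in>E. fst (ends e) \<in> C}. edge_pt ends e ` {0..1})"

definition division :: "'e set \<Rightarrow> ('e \<Rightarrow> 'v \<times> 'v) \<Rightarrow> ('v, 'e) cpt set \<Rightarrow> ('v, 'e) cpt set \<Rightarrow> bool" where
  "division E ends \<alpha> \<beta> \<longleftrightarrow> piece E ends \<alpha> \<and> piece E ends \<beta> \<and> \<alpha> \<union> \<beta> = cake E ends \<and> finite (\<alpha> \<inter> \<beta>)"

definition weighted_consensus ::
  "('v, 'e) cpt measure \<Rightarrow> ('v, 'e) cpt measure \<Rightarrow> real \<Rightarrow> ('v, 'e) cpt set \<Rightarrow> ('v, 'e) cpt set \<Rightarrow> bool" where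
  "weighted_consensus vA vB t \<alpha> \<beta> \<longleftrightarrow>
     measure vA \<alpha> = t \<and> measure vB \<alpha> = t \<and> measure vA \<beta> = 1 - t \<and> measure vB \<beta> = 1 - t"

end

(* Orient the edges of every component away from a centre and list them in depth-first order, a
   non-tree edge counting as a pendant edge at its nearer end.  A segment of this list touches only the at most
   r + 1 ancestors of its first edge and otherwise hangs together, so it has at most r + 2 components;
   a prefix is connected.  Concatenating the lists of all components turns both valuations into
   distribution functions on one segment, and an arc with value t for both exists because, in the
   coordinate (v_A + v_B) / 2, the difference v_A - v_B is a continuous function on a circle, whose
   increment over arcs of length t changes sign.  The two cut points lie in at most two components. *)

theory Submission
  imports Defs
begin

section \<open>The topology of the cake\<close>

text \<open>The obstacle is that a stretch of the list that starts inside a component falls apart: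
  its edges may hang off ancestors that lie outside it. But points carry no mass and a division
  tolerates a finite overlap, so the ancestors themselves are added to the stretch as points.
  Unconnected, they account for \<open>r + 1\<close> components, the rest of the cut edge for one
  more, and every later edge attaches to something present. The part outside an arc within one
  component is such a stretch together with a prefix. The prefix costs nothing, because it contains
  the centre, which is among the added ancestors. When the cuts lie in two components, each piece
  receives a suffix of one list and a prefix of another; these are disjoint, so the prefix counts 1
  and \<open>r + 2\<close> becomes \<open>r + 3\<close>. Path components are never determined
  exactly; they are bounded by coverings with path-connected sets. Nor is a spanning tree built:
  only a bound on the number of ancestors is carried along.\<close>

lemma cake_open_subset: "cake_open E ends U \<Longrightarrow> U \<subseteq> cake E ends"
  unfolding cake_open_def by (elim conjE)

lemma cake_open_edge: "cake_open E ends U \<Longrightarrow> e \<in> E \<Longrightarrow> open {x. 0 < x \<and> x < 1 \<and> Inner e x \<in> U}"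
  unfolding cake_open_def by (elim conjE) (drule (1) bspec)

lemma cake_open_vertex:
  assumes "cake_open E ends U" "Vtx v \<in> U"
  shows "\<exists>d>0. d < 1 \<and>
    (\<forall>e\<in>E. \<forall>x. fst (ends e) = v \<longrightarrow> 0 < x \<longrightarrow> x < d \<longrightarrow> Inner e x \<in> U) \<and>
    (\<forall>e\<in>E. \<forall>x. snd (ends e) = v \<longrightarrow> 1 - d < x \<longrightarrow> x < 1 \<longrightarrow> Inner e x \<in> U)"
proof -
  have "\<exists>\<epsilon>>0. \<epsilon> < 1 \<and> (\<forall>e\<in>E.
        (fst (ends e) = v \<longrightarrow> (\<forall>x. 0 < x \<and> x < \<epsilon> \<longrightarrow> Inner e x \<in> U)) \<and>
        (snd (ends e) = v \<longrightarrow> (\<forall>x. 1 - \<epsilon> < x \<and> x < 1 \<longrightarrow> Inner e x \<in> U)))"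
    using assms unfolding cake_open_def by (elim conjE) (erule allE[of _ v], simp)
  then show ?thesis
    by (elim exE conjE) (rule exI, intro conjI; blast)
qed

lemma istopology_cake_open: "istopology (cake_open E ends)"
  unfolding istopology_def
proof (intro conjI allI impI)
  fix S T assume ST: "cake_open E ends S" "cake_open E ends T"
  show "cake_open E ends (S \<inter> T)"
    unfolding cake_open_def
  proof (intro conjI ballI allI impI)
    show "S \<inter> T \<subseteq> cake E ends"
      using cake_open_subset[OF ST(1)] by blast
    fix e assume "e \<in> E"
    then have "open ({x. 0 < x \<and> x < 1 \<and> Inner e x \<in> S} \<inter> {x. 0 < x \<and> x < 1 \<and> Inner e x \<in> T})"
      using ST by (intro open_Int cake_open_edge)
    moreover have "{x. 0 < x \<and> x < 1 \<and> Inner e x \<in> S} \<inter> {x. 0 < x \<and> x < 1 \<and> Inner e x \<in> T}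
        = {x. 0 < x \<and> x < 1 \<and> Inner e x \<in> S \<inter> T}"
      by auto
    ultimately show "open {x. 0 < x \<and> x < 1 \<and> Inner e x \<in> S \<inter> T}"
      by simp
  next
    fix v assume v: "Vtx v \<in> S \<inter> T"
    obtain d where d: "d > 0" "d < 1"
      "\<forall>e\<in>E. \<forall>x. fst (ends e) = v \<longrightarrow> 0 < x \<longrightarrow> x < d \<longrightarrow> Inner e x \<in> S"
      "\<forall>e\<in>E. \<forall>x. snd (ends e) = v \<longrightarrow> 1 - d < x \<longrightarrow> x < 1 \<longrightarrow> Inner e x \<in> S"
      using cake_open_vertex[OF ST(1) IntD1[OF v]] by (elim exE conjE)
    obtain d' where d': "d' > 0" "d' < 1"
      "\<forall>e\<in>E. \<forall>x. fst (ends e) = v \<longrightarrow> 0 < x \<longrightarrow> x < d' \<longrightarrow> Inner e x \<in> T"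
      "\<forall>e\<in>E. \<forall>x. snd (ends e) = v \<longrightarrow> 1 - d' < x \<longrightarrow> x < 1 \<longrightarrow> Inner e x \<in> T"
      using cake_open_vertex[OF ST(2) IntD2[OF v]] by (elim exE conjE)
    show "\<exists>\<epsilon>>0. \<epsilon> < 1 \<and> (\<forall>e\<in>E.
        (fst (ends e) = v \<longrightarrow> (\<forall>x. 0 < x \<and> x < \<epsilon> \<longrightarrow> Inner e x \<in> S \<inter> T)) \<and>
        (snd (ends e) = v \<longrightarrow> (\<forall>x. 1 - \<epsilon> < x \<and> x < 1 \<longrightarrow> Inner e x \<in> S \<inter> T)))"
      using d d' by (intro exI[of _ "min d d'"]) auto
  qed
next
  fix \<K> assume K: "\<forall>K\<in>\<K>. cake_open E ends K"
  show "cake_open E ends (\<Union>\<K>)"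
    unfolding cake_open_def
  proof (intro conjI ballI allI impI)
    show "\<Union>\<K> \<subseteq> cake E ends"
      using K cake_open_subset by (intro Union_least) blast
    fix e assume "e \<in> E"
    then have "open (\<Union>S\<in>\<K>. {x. 0 < x \<and> x < 1 \<and> Inner e x \<in> S})"
      using K by (intro open_UN ballI cake_open_edge) auto
    moreover have "(\<Union>S\<in>\<K>. {x. 0 < x \<and> x < 1 \<and> Inner e x \<in> S})
        = {x. 0 < x \<and> x < 1 \<and> Inner e x \<in> \<Union>\<K>}"
      by auto
    ultimately show "open {x. 0 < x \<and> x < 1 \<and> Inner e x \<in> \<Union>\<K>}"
      by simp
  next
    fix v assume "Vtx v \<in> \<Union>\<K>"
    then obtain S where S: "S \<in> \<K>" "Vtx v \<in> S"
      by blast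
    obtain d where d: "d > 0" "d < 1"
      "\<forall>e\<in>E. \<forall>x. fst (ends e) = v \<longrightarrow> 0 < x \<longrightarrow> x < d \<longrightarrow> Inner e x \<in> S"
      "\<forall>e\<in>E. \<forall>x. snd (ends e) = v \<longrightarrow> 1 - d < x \<longrightarrow> x < 1 \<longrightarrow> Inner e x \<in> S"
      using cake_open_vertex[OF bspec[OF K S(1)] S(2)] by (elim exE conjE)
    then show "\<exists>\<epsilon>>0. \<epsilon> < 1 \<and> (\<forall>e\<in>E.
        (fst (ends e) = v \<longrightarrow> (\<forall>x. 0 < x \<and> x < \<epsilon> \<longrightarrow> Inner e x \<in> \<Union>\<K>)) \<and>
        (snd (ends e) = v \<longrightarrow> (\<forall>x. 1 - \<epsilon> < x \<and> x < 1 \<longrightarrow> Inner e x \<in> \<Union>\<K>)))"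
      using S(1) by (intro exI[of _ d]) blast
  qed
qed

lemma openin_cake_top [simp]: "openin (cake_top E ends) U \<longleftrightarrow> cake_open E ends U"
  unfolding cake_top_def using istopology_cake_open by (metis topology_inverse')

lemma Inner_in_cake_iff: "0 < x \<Longrightarrow> x < 1 \<Longrightarrow> Inner e x \<in> cake E ends \<longleftrightarrow> e \<in> E"
  by (auto simp: cake_def edge_pt_def image_iff split: if_splits intro!: bexI[of _ x])

lemma Vtx_in_cake_iff: "Vtx v \<in> cake E ends \<longleftrightarrow> (\<exists>e\<in>E. v = fst (ends e) \<or> v = snd (ends e))"
proof
  assume "\<exists>e\<in>E. v = fst (ends e) \<or> v = snd (ends e)"
  then obtain e where e: "e \<in> E" "v = fst (ends e) \<or> v = snd (ends e)"
    by blast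
  then have "Vtx v = edge_pt ends e 0 \<or> Vtx v = edge_pt ends e 1"
    by (auto simp: edge_pt_def)
  then show "Vtx v \<in> cake E ends"
    unfolding cake_def using e(1) by force
qed (auto simp: cake_def edge_pt_def split: if_splits)

lemma cake_open_without_vertices:
  assumes "U \<subseteq> cake E ends"
    and "\<And>e. e \<in> E \<Longrightarrow> open {x. 0 < x \<and> x < 1 \<and> Inner e x \<in> U}"
    and "\<And>v. Vtx v \<notin> U"
  shows "cake_open E ends U"
  using assms unfolding cake_open_def by auto

text \<open>This makes singletons Borel, so that non-atomicity turns every finite subset of the cake
  into a null set.\<close>

lemma cake_open_minus_singleton: "cake_open E ends (cake E ends - {p})"
  unfolding cake_open_def
proof (intro conjI ballI allI impI)
  fix e assume e: "e \<in> E"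
  show "open {x. 0 < x \<and> x < 1 \<and> Inner e x \<in> cake E ends - {p}}"
  proof (cases p)
    case (Vtx v)
    then have "{x. 0 < x \<and> x < 1 \<and> Inner e x \<in> cake E ends - {p}} = {0<..<1}"
      using e by (auto simp: Inner_in_cake_iff)
    then show ?thesis by simp
  next
    case (Inner e' y)
    then have "{x. 0 < x \<and> x < 1 \<and> Inner e x \<in> cake E ends - {p}} =
        (if e = e' then {0<..<1} - {y} else {0<..<1})"
      using e by (auto simp: Inner_in_cake_iff)
    then show ?thesis by (simp add: open_delete)
  qed
next
  fix v assume "Vtx v \<in> cake E ends - {p}"
  \<comment> \<open>For an interior point \<open>p\<close> this is its distance to the nearer end of
    its edge, so a neighbourhood of a vertex stops short of \<open>p\<close> from either side;
    otherwise any value below 1 serves.\<close>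
  define d where "d = (case p of Vtx w \<Rightarrow> 1/2 | Inner e y \<Rightarrow> if 0 < y \<and> y < 1 then min y (1 - y) else 1/2)"
  have d: "0 < d" "d < 1"
    unfolding d_def by (auto split: cpt.splits)
  have "Inner e x \<in> cake E ends - {p}" if "e \<in> E" "0 < x \<and> x < d \<or> 1 - d < x \<and> x < 1" for e x
  proof -
    have x: "0 < x" "x < 1"
      using that(2) d by auto
    have "Inner e x \<noteq> p"
    proof
      assume p: "Inner e x = p"
      have "d = min x (1 - x)"
        unfolding d_def p[symmetric] using x by simp
      then show False
        using that(2) by auto
    qed
    then show ?thesis
      using x that(1) by (simp add: Inner_in_cake_iff)
  qed
  then show "\<exists>\<epsilon>>0. \<epsilon> < 1 \<and> (\<forall>e\<in>E.
        (fst (ends e) = v \<longrightarrow> (\<forall>x. 0 < x \<and> x < \<epsilon> \<longrightarrow> Inner e x \<in> cake E ends - {p})) \<and>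
        (snd (ends e) = v \<longrightarrow> (\<forall>x. 1 - \<epsilon> < x \<and> x < 1 \<longrightarrow> Inner e x \<in> cake E ends - {p})))"
    using d by blast
qed auto

lemma cake_open_cake: "cake_open E ends (cake E ends)"
  unfolding cake_open_def
proof (intro conjI ballI allI impI)
  fix e assume e: "e \<in> E"
  then have "{x. 0 < x \<and> x < 1 \<and> Inner e x \<in> cake E ends} = {0<..<1}"
    by (auto simp: Inner_in_cake_iff)
  then show "open {x. 0 < x \<and> x < 1 \<and> Inner e x \<in> cake E ends}"
    by simp
next
  fix v
  show "\<exists>\<epsilon>>0. \<epsilon> < 1 \<and> (\<forall>e\<in>E.
        (fst (ends e) = v \<longrightarrow> (\<forall>x. 0 < x \<and> x < \<epsilon> \<longrightarrow> Inner e x \<in> cake E ends)) \<and>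
        (snd (ends e) = v \<longrightarrow> (\<forall>x. 1 - \<epsilon> < x \<and> x < 1 \<longrightarrow> Inner e x \<in> cake E ends)))"
    by (intro exI[of _ "1/2"]) (auto simp: Inner_in_cake_iff)
qed auto

lemma topspace_cake_top [simp]: "topspace (cake_top E ends) = cake E ends"
proof (rule antisym)
  show "topspace (cake_top E ends) \<subseteq> cake E ends"
    using openin_topspace[of "cake_top E ends"] unfolding openin_cake_top by (rule cake_open_subset)
  show "cake E ends \<subseteq> topspace (cake_top E ends)"
    by (intro openin_subset) (simp add: cake_open_cake)
qed

text \<open>Arcs of edges are path-connected through this map. The vertex clause of
  \<open>cake_open\<close> supplies exactly what continuity at 0 and at 1 requires.\<close>

lemma continuous_map_edge_pt:
  assumes e: "e \<in> E"
  shows "continuous_map (top_of_set {0..1}) (cake_top E ends) (edge_pt ends e)"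
  unfolding continuous_map_def
proof (intro conjI allI impI)
  show "edge_pt ends e \<in> topspace (top_of_set {0..1}) \<rightarrow> topspace (cake_top E ends)"
    using e by (auto simp: cake_def)
next
  fix U assume "openin (cake_top E ends) U"
  then have U: "cake_open E ends U"
    by simp
  show "openin (top_of_set {0..1}) {x \<in> topspace (top_of_set {0..1}). edge_pt ends e x \<in> U}"
    unfolding openin_euclidean_subtopology_iff
  proof (intro conjI ballI)
    show "{x \<in> topspace (top_of_set {0..1}). edge_pt ends e x \<in> U} \<subseteq> {0..1}"
      by (simp add: subset_iff)
  next
    fix x assume "x \<in> {x \<in> topspace (top_of_set {0..1}). edge_pt ends e x \<in> U}"
    then have x: "0 \<le> x" "x \<le> 1" "edge_pt ends e x \<in> U"
      by auto
    consider "x = 0" | "x = 1" | "0 < x" "x < 1"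
      using x by linarith
    then show "\<exists>d>0. \<forall>x'\<in>{0..1}. dist x' x < d \<longrightarrow>
        x' \<in> {x \<in> topspace (top_of_set {0..1}). edge_pt ends e x \<in> U}"
    proof cases
      case 1
      then have v: "Vtx (fst (ends e)) \<in> U"
        using x by (simp add: edge_pt_def)
      obtain d where "d > 0" "d < 1" "\<And>x. 0 < x \<Longrightarrow> x < d \<Longrightarrow> Inner e x \<in> U"
        using e cake_open_vertex[OF U v] by metis
      then show ?thesis
        using 1 x by (intro exI[of _ d]) (auto simp: dist_real_def edge_pt_def)
    next
      case 2
      then have v: "Vtx (snd (ends e)) \<in> U"
        using x by (simp add: edge_pt_def)
      obtain d where "d > 0" "d < 1" "\<And>x. 1 - d < x \<Longrightarrow> x < 1 \<Longrightarrow> Inner e x \<in> U"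
        using e cake_open_vertex[OF U v] by metis
      then show ?thesis
        using 2 x by (intro exI[of _ d]) (auto simp: dist_real_def edge_pt_def)
    next
      case 3
      have "open {x. 0 < x \<and> x < 1 \<and> Inner e x \<in> U}"
        using U e by (rule cake_open_edge)
      moreover have "x \<in> {x. 0 < x \<and> x < 1 \<and> Inner e x \<in> U}"
        using 3 x by (auto simp: edge_pt_def)
      ultimately obtain d where d: "d > 0" "ball x d \<subseteq> {x. 0 < x \<and> x < 1 \<and> Inner e x \<in> U}"
        using open_contains_ball by blast
      have "edge_pt ends e y \<in> U" if "dist y x < d" for y
      proof -
        have "y \<in> {x. 0 < x \<and> x < 1 \<and> Inner e x \<in> U}"
          using that d by (auto simp: subset_iff dist_commute)
        then show ?thesis
          by (auto simp: edge_pt_def)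
      qed
      then show ?thesis
        using d(1) by (intro exI[of _ d]) simp
    qed
  qed
qed

section \<open>Counting path components\<close>

text \<open>An upper bound for the number of path components that is easy to combine: bounds add
  over unions, and a path-connected set that meets the rest is free. Members of the family may
  overlap or be empty.\<close>

definition covered :: "'a topology \<Rightarrow> nat \<Rightarrow> 'a set \<Rightarrow> bool" where
  "covered X n P \<longleftrightarrow> (\<exists>\<S>. finite \<S> \<and> card \<S> \<le> n \<and> P = \<Union>\<S> \<and> (\<forall>S\<in>\<S>. path_connectedin X S))"

lemma covered_mono: "covered X m P \<Longrightarrow> m \<le> n \<Longrightarrow> covered X n P"
  unfolding covered_def using le_trans by blast

lemma covered_path_connectedin: "path_connectedin X P \<Longrightarrow> covered X 1 P"
  unfolding covered_def by (intro exI[of _ "{P}"]) auto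

lemma covered_empty: "covered X 0 {}"
  unfolding covered_def by (intro exI[of _ "{}"]) auto

lemma covered_Un:
  assumes "covered X m P" "covered X n Q"
  shows "covered X (m + n) (P \<union> Q)"
proof -
  obtain \<S> where S: "finite \<S>" "card \<S> \<le> m" "P = \<Union>\<S>" "\<forall>S\<in>\<S>. path_connectedin X S"
    using assms(1) unfolding covered_def by blast
  obtain \<T> where T: "finite \<T>" "card \<T> \<le> n" "Q = \<Union>\<T>" "\<forall>S\<in>\<T>. path_connectedin X S"
    using assms(2) unfolding covered_def by blast
  have "card (\<S> \<union> \<T>) \<le> m + n"
    using card_Un_le[of \<S> \<T>] S(2) T(2) by linarith
  then show ?thesis
    unfolding covered_def using S T by (intro exI[of _ "\<S> \<union> \<T>"]) auto
qed

lemma covered_UN: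
  assumes "finite I" "\<And>i. i \<in> I \<Longrightarrow> covered X 1 (f i)"
  shows "covered X (card I) (\<Union>i\<in>I. f i)"
  using assms
proof (induction I)
  case (insert i I)
  then have "covered X (1 + card I) (f i \<union> (\<Union>i\<in>I. f i))"
    by (intro covered_Un) auto
  then show ?case
    using insert by simp
qed (simp add: covered_empty)

text \<open>The member that meets \<open>Q\<close> absorbs it, so the family does not grow. This is
  why an edge hanging off a vertex already present costs nothing.\<close>

lemma covered_attach:
  assumes "covered X n P" "path_connectedin X Q" "P \<inter> Q \<noteq> {}"
  shows "covered X n (P \<union> Q)"
proof -
  obtain \<S> where S: "finite \<S>" "card \<S> \<le> n" "P = \<Union>\<S>" "\<forall>S\<in>\<S>. path_connectedin X S"
    using assms(1) unfolding covered_def by blast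
  then obtain S where S': "S \<in> \<S>" "S \<inter> Q \<noteq> {}"
    using assms(3) by blast
  have "card (insert (S \<union> Q) (\<S> - {S})) \<le> n"
  proof -
    have "card (insert (S \<union> Q) (\<S> - {S})) \<le> Suc (card (\<S> - {S}))"
      using S(1) by (simp add: card_insert_if)
    also have "\<dots> = card \<S>"
      using card.remove[OF S(1) S'(1)] by simp
    finally show ?thesis
      using S(2) by linarith
  qed
  moreover have "P \<union> Q = \<Union>(insert (S \<union> Q) (\<S> - {S}))"
    unfolding S(3) using S'(1) by blast
  moreover have "path_connectedin X (S \<union> Q)"
    using S S' assms(2) by (intro path_connectedin_Un) auto
  ultimately show ?thesis
    unfolding covered_def using S by (intro exI[of _ "insert (S \<union> Q) (\<S> - {S})"]) auto
qed

text \<open>A component that meets a path-connected member contains it, so it is the component of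
  the point chosen in that member. The components are thus among finitely many sets, and
  \<open>card\<close> is a genuine count. For an empty member the chosen point is arbitrary, which
  is harmless because only an inclusion is claimed.\<close>

lemma card_path_components_le:
  assumes "covered X n P"
  shows "card (path_components_of (subtopology X P)) \<le> n"
proof -
  obtain \<S> where S: "finite \<S>" "card \<S> \<le> n" "P = \<Union>\<S>" "\<forall>S\<in>\<S>. path_connectedin X S"
    using assms unfolding covered_def by blast
  let ?Y = "subtopology X P"
  let ?f = "\<lambda>S. Collect (path_component_of ?Y (SOME x. x \<in> S))"
  have "path_components_of ?Y \<subseteq> ?f ` \<S>"
  proof
    fix K assume "K \<in> path_components_of ?Y"
    then obtain x where x: "x \<in> topspace ?Y" "K = Collect (path_component_of ?Y x)"
      unfolding path_components_of_def by blast
    then obtain S' where S': "S' \<in> \<S>" "x \<in> S'"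
      using S by auto
    have "path_connectedin ?Y S'"
      using S S' by (auto simp: path_connectedin_subtopology)
    moreover have "(SOME x. x \<in> S') \<in> S'"
      using S'(2) by (rule someI)
    ultimately have "S' \<subseteq> Collect (path_component_of ?Y (SOME x. x \<in> S'))"
      by (rule path_component_of_maximal)
    then have "path_component_of ?Y (SOME x. x \<in> S') x"
      using S'(2) by (rule subsetD[THEN CollectD])
    from iffD1[OF path_component_of_equiv this]
    have "path_component_of ?Y (SOME x. x \<in> S') = path_component_of ?Y x"
      by (elim conjE)
    then have "K = ?f S'"
      unfolding x(2) by (simp only:)
    then show "K \<in> ?f ` \<S>"
      using S'(1) by blast
  qed
  then have "card (path_components_of ?Y) \<le> card \<S>"
    using S(1) by (simp add: surj_card_le)
  then show ?thesis
    using S(2) by linarith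
qed

lemma ncomp_le: "covered (cake_top E ends) n P \<Longrightarrow> ncomp E ends P \<le> n"
  unfolding ncomp_def by (rule card_path_components_le)

section \<open>Depth-first orderings of oriented edges\<close>

text \<open>An oriented edge is a pair \<open>(e, b)\<close>; the flag \<open>b\<close> says that \<open>e\<close> is traversed backwards.\<close>

definition tail_of :: "('e \<Rightarrow> 'v \<times> 'v) \<Rightarrow> 'e \<times> bool \<Rightarrow> 'v" where
  "tail_of ends g = (if snd g then snd (ends (fst g)) else fst (ends (fst g)))"

definition head_of :: "('e \<Rightarrow> 'v \<times> 'v) \<Rightarrow> 'e \<times> bool \<Rightarrow> 'v" where
  "head_of ends g = (if snd g then fst (ends (fst g)) else snd (ends (fst g)))"

definition opoint :: "('e \<Rightarrow> 'v \<times> 'v) \<Rightarrow> 'e \<times> bool \<Rightarrow> real \<Rightarrow> ('v, 'e) cpt" where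
  "opoint ends g z = edge_pt ends (fst g) (if snd g then 1 - z else z)"

definition full :: "('e \<Rightarrow> 'v \<times> 'v) \<Rightarrow> ('e \<times> bool) list \<Rightarrow> ('v, 'e) cpt set" where
  "full ends gs = (\<Union>g\<in>set gs. opoint ends g ` {0..1})"

text \<open>Says that attaching the edges one at a time to a set containing \<open>A\<close> never
  opens a new component. It is monotone in \<open>A\<close>, which is what allows further edges to
  be inserted into a list.\<close>

fun reach :: "('e \<Rightarrow> 'v \<times> 'v) \<Rightarrow> 'v set \<Rightarrow> ('e \<times> bool) list \<Rightarrow> bool" where
  "reach ends A [] \<longleftrightarrow> True"
| "reach ends A (g # gs) \<longleftrightarrow> tail_of ends g \<in> A \<and> reach ends (insert (head_of ends g) A) gs"

text \<open>\<open>A\<close> stands for the vertices on a path from the root \<open>c\<close> to the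
  tail of \<open>g\<close>, one for each distance from 0 to that of the tail, whence the
  \<open>Suc\<close>. The set \<open>K\<close> serves to keep them inside the cake.\<close>

fun tails_reach :: "('e \<Rightarrow> 'v \<times> 'v) \<Rightarrow> ('v \<Rightarrow> nat) \<Rightarrow> 'v set \<Rightarrow> 'v \<Rightarrow> ('e \<times> bool) list \<Rightarrow> bool" where
  "tails_reach ends d K c [] \<longleftrightarrow> True"
| "tails_reach ends d K c (g # gs) \<longleftrightarrow>
     (\<exists>A. finite A \<and> card A \<le> Suc (d (tail_of ends g)) \<and> c \<in> A \<and> A \<subseteq> K \<and>
          reach ends (insert (head_of ends g) A) gs) \<and>
     tails_reach ends d K c gs"

lemma opoint_0 [simp]: "opoint ends g 0 = Vtx (tail_of ends g)"
  by (simp add: opoint_def tail_of_def edge_pt_def)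

lemma opoint_1 [simp]: "opoint ends g 1 = Vtx (head_of ends g)"
  by (simp add: opoint_def head_of_def edge_pt_def)

lemma opoint_inner: "0 < z \<Longrightarrow> z < 1 \<Longrightarrow> opoint ends g z = Inner (fst g) (if snd g then 1 - z else z)"
  by (simp add: opoint_def edge_pt_def)

lemma reach_mono: "reach ends A gs \<Longrightarrow> A \<subseteq> B \<Longrightarrow> reach ends B gs"
proof (induction gs arbitrary: A B)
  case (Cons g gs)
  then show ?case
    using Cons.IH[of "insert (head_of ends g) A" "insert (head_of ends g) B"] by auto
qed simp

lemma reach_append:
  "reach ends A (us @ vs) \<longleftrightarrow> reach ends A us \<and> reach ends (A \<union> head_of ends ` set us) vs"
  by (induction us arbitrary: A) (auto simp: Un_commute)

lemma reach_insert:
  assumes "reach ends A (us @ g # vs)" "tail_of ends h = head_of ends g"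
  shows "reach ends A (us @ g # h # vs)"
  using assms by (auto simp: reach_append elim!: reach_mono)

text \<open>The new edge inherits the ancestors of \<open>g\<close> and adds the head of
  \<open>g\<close>: one vertex more, paid for by a tail that is one step deeper. Edges before
  \<open>h\<close> keep their sets, since \<open>h\<close> hangs off \<open>g\<close>, and edges
  after it do not see the change.\<close>

lemma tails_reach_insert:
  assumes "tails_reach ends d K c (us @ g # vs)" "tail_of ends h = head_of ends g"
    and "d (tail_of ends h) = Suc (d (tail_of ends g))" "head_of ends g \<in> K"
  shows "tails_reach ends d K c (us @ g # h # vs)"
  using assms(1)
proof (induction us)
  case Nil
  then obtain A where A: "finite A" "card A \<le> Suc (d (tail_of ends g))" "c \<in> A" "A \<subseteq> K"
      "reach ends (insert (head_of ends g) A) vs" and tl: "tails_reach ends d K c vs"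
    by auto
  let ?A = "insert (head_of ends g) A"
  have "finite ?A \<and> card ?A \<le> Suc (d (tail_of ends h)) \<and> c \<in> ?A \<and> ?A \<subseteq> K \<and>
      reach ends (insert (head_of ends h) ?A) vs"
    using A assms(3,4) card_insert_le_m1[of _ A] by (auto simp: card_insert_if elim!: reach_mono)
  moreover have "reach ends (insert (head_of ends g) A) (h # vs)"
    using A(5) assms(2) by (auto elim!: reach_mono)
  ultimately have "tails_reach ends d K c (h # vs)" "reach ends (insert (head_of ends g) A) (h # vs)"
    using tl unfolding tails_reach.simps by blast+
  then show ?case
    using A unfolding append_Nil tails_reach.simps(2)[of ends d K c g] by blast
next
  case (Cons u us)
  then obtain A where A: "finite A" "card A \<le> Suc (d (tail_of ends u))" "c \<in> A" "A \<subseteq> K"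
      "reach ends (insert (head_of ends u) A) (us @ g # vs)"
    by auto
  then have "reach ends (insert (head_of ends u) A) (us @ g # h # vs)"
    using assms(2) reach_insert by blast
  moreover have "tails_reach ends d K c (us @ g # h # vs)"
    using Cons by simp
  ultimately show ?case
    using A unfolding append_Cons tails_reach.simps(2)[of ends d K c u] by blast
qed

lemma tails_reach_split:
  assumes "tails_reach ends d K c (us @ g # vs)"
  shows "\<exists>A. finite A \<and> card A \<le> Suc (d (tail_of ends g)) \<and> c \<in> A \<and> A \<subseteq> K \<and>
    reach ends (insert (head_of ends g) A) vs"
  using assms by (induction us) auto

text \<open>Inserting the edges in breadth-first order, each immediately behind the edge that leads to
  its tail, produces a depth-first ordering.\<close>

lemma depth_first_list_exists:
  fixes d :: "'v \<Rightarrow> nat" and dir :: "'e \<Rightarrow> bool"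
  defines "o_edge \<equiv> \<lambda>e. (e, dir e)"
  assumes "finite F"
    and root: "\<And>e. e \<in> F \<Longrightarrow> d (tail_of ends (o_edge e)) = 0 \<Longrightarrow> tail_of ends (o_edge e) = c"
    and parent: "\<And>e. e \<in> F \<Longrightarrow> d (tail_of ends (o_edge e)) \<noteq> 0 \<Longrightarrow>
      \<exists>e'\<in>F. head_of ends (o_edge e') = tail_of ends (o_edge e) \<and>
        d (tail_of ends (o_edge e)) = Suc (d (tail_of ends (o_edge e')))"
    and K: "\<And>e. e \<in> F \<Longrightarrow> tail_of ends (o_edge e) \<in> K \<and> head_of ends (o_edge e) \<in> K"
  shows "\<exists>gs. distinct (map fst gs) \<and> set gs = o_edge ` F \<and> reach ends {c} gs \<and> tails_reach ends d K c gs"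
  using assms(2-)
proof (induction F rule: finite_ranking_induct[where f = "\<lambda>e. d (tail_of ends (o_edge e))"])
  case empty
  show ?case by (intro exI[of _ "[]"]) auto
next
  case (insert x S)
  have "\<exists>gs. distinct (map fst gs) \<and> set gs = o_edge ` S \<and> reach ends {c} gs \<and> tails_reach ends d K c gs"
  proof (rule insert.IH)
    fix e assume e: "e \<in> S" "d (tail_of ends (o_edge e)) \<noteq> 0"
    then obtain e' where e': "e' \<in> insert x S" "head_of ends (o_edge e') = tail_of ends (o_edge e)"
        "d (tail_of ends (o_edge e)) = Suc (d (tail_of ends (o_edge e')))"
      using insert.prems(2) by blast
    \<comment> \<open>A parent has a strictly nearer tail, whereas the tail of \<open>x\<close> is
      at least as far away as all those in \<open>S\<close>.\<close>
    moreover have "e' \<noteq> x"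
      using e'(3) insert.hyps(2)[OF e(1)] by auto
    ultimately show "\<exists>e'\<in>S. head_of ends (o_edge e') = tail_of ends (o_edge e) \<and>
        d (tail_of ends (o_edge e)) = Suc (d (tail_of ends (o_edge e')))"
      by blast
  qed (use insert.prems in auto)
  then obtain gs where gs: "distinct (map fst gs)" "set gs = o_edge ` S" "reach ends {c} gs"
      "tails_reach ends d K c gs"
    by blast
  let ?x = "o_edge x"
  have xK: "tail_of ends ?x \<in> K" "head_of ends ?x \<in> K"
    using insert.prems(3) by blast+
  have fst_gs: "fst ` set gs = S"
    unfolding gs(2) by (auto simp: o_edge_def image_iff)
  \<comment> \<open>The ranking induction does not supply \<open>x \<notin> S\<close>, hence the
    first case.\<close>
  consider "x \<in> S" | "x \<notin> S" "d (tail_of ends ?x) = 0" | "x \<notin> S" "d (tail_of ends ?x) \<noteq> 0"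
    by blast
  then show ?case
  proof cases
    case 1
    then have "insert x S = S" by blast
    then show ?thesis using gs by auto
  next
    case 2
    then have c: "tail_of ends ?x = c"
      using insert.prems(1) by blast
    \<comment> \<open>An edge at the root has no parent to follow and goes to the very front: its
      only ancestor is \<open>c\<close>, from which all of \<open>gs\<close> can be reached.\<close>
    have "reach ends {c} (?x # gs)" "reach ends (insert (head_of ends ?x) {c}) gs"
      using gs(3) c by (auto elim!: reach_mono)
    moreover from this have "tails_reach ends d K c (?x # gs)"
      using gs(4) c xK by (auto intro!: exI[of _ "{c}"])
    moreover have "distinct (map fst (?x # gs))"
      using gs(1) fst_gs 2(1) by (simp add: o_edge_def)
    ultimately show ?thesis
      using gs(2) by (intro exI[of _ "?x # gs"]) auto
  next
    case 3
    then obtain e' where e': "e' \<in> insert x S" "head_of ends (o_edge e') = tail_of ends ?x"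
        "d (tail_of ends ?x) = Suc (d (tail_of ends (o_edge e')))"
      using insert.prems(2) by blast
    then have "e' \<in> S" by auto
    then have "o_edge e' \<in> set gs"
      using gs(2) by blast
    then obtain us vs where split: "gs = us @ o_edge e' # vs"
      by (meson split_list)
    let ?gs = "us @ o_edge e' # ?x # vs"
    have "reach ends {c} ?gs"
      using gs(3) e'(2) unfolding split by (intro reach_insert) auto
    moreover have "tails_reach ends d K c ?gs"
      using gs(4) e'(2,3) xK unfolding split by (intro tails_reach_insert) auto
    moreover have "distinct (map fst ?gs)"
      using gs(1) fst_gs 3(1) unfolding split by (auto simp: o_edge_def)
    moreover have "set ?gs = o_edge ` insert x S"
      using gs(2) unfolding split by auto
    ultimately show ?thesis
      by blast
  qed
qed

text \<open>Ancestors are demanded at every split of the list because a cut may fall on any edge.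
  They must lie in \<open>comp_cake\<close>, since they are going to be added to pieces.\<close>

definition dfs_order :: "'e set \<Rightarrow> ('e \<Rightarrow> 'v \<times> 'v) \<Rightarrow> 'v set \<Rightarrow> 'v \<Rightarrow> ('e \<times> bool) list \<Rightarrow> bool" where
  "dfs_order E ends C c gs \<longleftrightarrow> distinct (map fst gs) \<and> fst ` set gs = {e\<in>E. fst (ends e) \<in> C} \<and>
     reach ends {c} gs \<and>
     (\<forall>us g vs. gs = us @ g # vs \<longrightarrow> (\<exists>A. finite A \<and> card A \<le> comp_radius E ends C + 1 \<and> c \<in> A \<and>
        Vtx ` A \<subseteq> comp_cake E ends C \<and> reach ends (insert (head_of ends g) A) vs))"

section \<open>Graph components, shortest paths and centres\<close>

lemma graph_components_equiv:
  assumes "graph_ok V E ends"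
  shows "equiv V {(v, w). v \<in> V \<and> w \<in> V \<and> (v, w) \<in> (adj E ends)\<^sup>*}"
proof -
  have "sym (adj E ends)"
    by (auto simp: sym_def adj_def)
  then have "sym ((adj E ends)\<^sup>*)"
    by (rule sym_rtrancl)
  then show ?thesis
    by (auto intro!: equivI refl_onI symI transI dest: symD intro: rtrancl_trans)
qed

lemma finite_graph_components: "graph_ok V E ends \<Longrightarrow> finite (graph_components V E ends)"
  unfolding graph_components_def graph_ok_def by (intro finite_quotient) auto

lemma Union_graph_components: "graph_ok V E ends \<Longrightarrow> \<Union>(graph_components V E ends) = V"
  unfolding graph_components_def by (rule Union_quotient[OF graph_components_equiv])

lemma graph_components_disjoint:
  assumes "graph_ok V E ends" "C \<in> graph_components V E ends" "D \<in> graph_components V E ends" "C \<noteq> D"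
  shows "C \<inter> D = {}"
  using quotient_disj[OF graph_components_equiv[OF assms(1)]] assms(2-) unfolding graph_components_def by blast

lemma graph_component_connected:
  assumes "graph_ok V E ends" "C \<in> graph_components V E ends" "v \<in> C" "w \<in> C"
  shows "(v, w) \<in> (adj E ends)\<^sup>*"
  using quotient_eqI[OF graph_components_equiv[OF assms(1)]] quotient_eq_iff[OF graph_components_equiv[OF assms(1)], of C C v w]
    assms(2-) unfolding graph_components_def by blast

lemma graph_component_closed:
  assumes "graph_ok V E ends" "C \<in> graph_components V E ends" "v \<in> C" "w \<in> V" "(v, w) \<in> (adj E ends)\<^sup>*"
  shows "w \<in> C"
proof -
  have "v \<in> V"
    using assms(1-3) Union_graph_components by blast
  then show ?thesis
    using in_quotient_imp_closed[OF graph_components_equiv[OF assms(1)], of C v w] assms(2-)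
    unfolding graph_components_def by blast
qed

lemma graph_component_edge_iff:
  assumes "graph_ok V E ends" "C \<in> graph_components V E ends" "e \<in> E"
  shows "fst (ends e) \<in> C \<longleftrightarrow> snd (ends e) \<in> C"
proof -
  have V: "fst (ends e) \<in> V" "snd (ends e) \<in> V"
    using assms(1,3) unfolding graph_ok_def by blast+
  have "(fst (ends e), snd (ends e)) \<in> (adj E ends)\<^sup>*" "(snd (ends e), fst (ends e)) \<in> (adj E ends)\<^sup>*"
    using assms(3) by (auto simp: adj_def intro!: r_into_rtrancl bexI[of _ e])
  then show ?thesis
    using graph_component_closed[OF assms(1,2)] V by blast
qed

lemma gdist_path: "(v, w) \<in> (adj E ends)\<^sup>* \<Longrightarrow> (v, w) \<in> adj E ends ^^ gdist E ends v w"
  unfolding gdist_def using rtrancl_imp_relpow by (metis LeastI)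

lemma gdist_le: "(v, w) \<in> adj E ends ^^ n \<Longrightarrow> gdist E ends v w \<le> n"
  unfolding gdist_def by (rule Least_le)

text \<open>The last step of a shortest path. It provides the parent of an edge whose tail is not
  the centre.\<close>

lemma gdist_pred:
  assumes "(v, w) \<in> (adj E ends)\<^sup>*" "gdist E ends v w \<noteq> 0"
  shows "\<exists>u. (u, w) \<in> adj E ends \<and> (v, u) \<in> (adj E ends)\<^sup>* \<and> gdist E ends v w = Suc (gdist E ends v u)"
proof -
  obtain n where n: "gdist E ends v w = Suc n"
    using assms(2) not0_implies_Suc by blast
  then have "(v, w) \<in> adj E ends ^^ Suc n"
    using gdist_path[OF assms(1)] by simp
  then obtain u where u: "(v, u) \<in> adj E ends ^^ n" "(u, w) \<in> adj E ends"
    by auto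
  then have vu: "(v, u) \<in> (adj E ends)\<^sup>*"
    using relpow_imp_rtrancl by blast
  then have "(v, w) \<in> adj E ends ^^ Suc (gdist E ends v u)"
    using gdist_path[OF vu] u(2) by auto
  then have "Suc n \<le> Suc (gdist E ends v u)"
    using gdist_le n by metis
  moreover have "gdist E ends v u \<le> n"
    using gdist_le[OF u(1)] .
  ultimately show ?thesis
    using u(2) vu n by auto
qed

lemma comp_radius_centre:
  assumes "finite C" "C \<noteq> {}"
  obtains c where "c \<in> C" "\<And>w. w \<in> C \<Longrightarrow> gdist E ends c w \<le> comp_radius E ends C"
proof -
  have "comp_radius E ends C \<in> (\<lambda>v. Max ((\<lambda>w. gdist E ends v w) ` C)) ` C"
    unfolding comp_radius_def using assms by (intro Min_in) auto
  then obtain c where c: "c \<in> C" "comp_radius E ends C = Max ((\<lambda>w. gdist E ends c w) ` C)"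
    by blast
  show thesis
  proof (rule that[OF c(1)])
    fix w assume "w \<in> C"
    then show "gdist E ends c w \<le> comp_radius E ends C"
      unfolding c(2) using assms(1) by (intro Max_ge) auto
  qed
qed

lemma Vtx_in_comp_cake:
  assumes "graph_ok V E ends" "C \<in> graph_components V E ends" "e \<in> E" "v = fst (ends e) \<or> v = snd (ends e)" "v \<in> C"
  shows "Vtx v \<in> comp_cake E ends C"
proof -
  have "fst (ends e) \<in> C"
    using assms graph_component_edge_iff[OF assms(1-3)] by blast
  moreover have "Vtx v = edge_pt ends e 0 \<or> Vtx v = edge_pt ends e 1"
    using assms(4) by (auto simp: edge_pt_def)
  ultimately show ?thesis
    unfolding comp_cake_def using assms(3) by force
qed

lemma dfs_order_exists:
  assumes ok: "graph_ok V E ends" and C: "C \<in> graph_components V E ends"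
  shows "\<exists>c gs. dfs_order E ends C c gs"
proof -
  have "C \<noteq> {}"
    using C in_quotient_imp_non_empty[OF graph_components_equiv[OF ok]] unfolding graph_components_def by blast
  moreover have "C \<subseteq> V"
    using Union_graph_components[OF ok] C by blast
  moreover from this have "finite C"
    using ok finite_subset unfolding graph_ok_def by blast
  ultimately obtain c where c: "c \<in> C" "\<And>w. w \<in> C \<Longrightarrow> gdist E ends c w \<le> comp_radius E ends C"
    using comp_radius_centre by blast
  define d where "d = gdist E ends c"
  \<comment> \<open>The tail becomes the end nearer to the centre; on a tie, in particular for a
    loop, the given direction is kept.\<close>
  define dir where "dir = (\<lambda>e. d (snd (ends e)) < d (fst (ends e)))"
  define F where "F = {e\<in>E. fst (ends e) \<in> C}"
  \<comment> \<open>This can be smaller than \<open>C\<close>: the vertex of an edgeless component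
    is not a point of the cake.\<close>
  define K where "K = {v. Vtx v \<in> comp_cake E ends C}"
  have conn: "(c, w) \<in> (adj E ends)\<^sup>*" if "w \<in> C" for w
    using graph_component_connected[OF ok C c(1) that] .
  have FC: "tail_of ends (e, b) \<in> C" "head_of ends (e, b) \<in> C" if "e \<in> F" for e b
    using that graph_component_edge_iff[OF ok C, of e] unfolding F_def tail_of_def head_of_def by auto
  have FK: "tail_of ends (e, b) \<in> K" "head_of ends (e, b) \<in> K" if "e \<in> F" for e b
  proof -
    have e: "e \<in> E"
      using that unfolding F_def by blast
    show "tail_of ends (e, b) \<in> K" "head_of ends (e, b) \<in> K"
      using FC[OF that, of b] Vtx_in_comp_cake[OF ok C e] unfolding K_def tail_of_def head_of_def
      by (auto split: if_splits)
  qed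
  have "\<exists>gs. distinct (map fst gs) \<and> set gs = (\<lambda>e. (e, dir e)) ` F \<and> reach ends {c} gs \<and> tails_reach ends d K c gs"
  proof (rule depth_first_list_exists)
    show "finite F"
      using ok unfolding F_def graph_ok_def by auto
    show "tail_of ends (e, dir e) = c" if "e \<in> F" "d (tail_of ends (e, dir e)) = 0" for e
      using gdist_path[OF conn[OF FC(1)[OF that(1), of "dir e"]]] that(2) unfolding d_def by simp
    show "tail_of ends (e, dir e) \<in> K \<and> head_of ends (e, dir e) \<in> K" if "e \<in> F" for e
      using FK[OF that] by blast
    fix e assume e: "e \<in> F" "d (tail_of ends (e, dir e)) \<noteq> 0"
    let ?w = "tail_of ends (e, dir e)"
    have w: "?w \<in> C" by (rule FC(1)[OF e(1)])
    obtain u where u: "(u, ?w) \<in> adj E ends" "(c, u) \<in> (adj E ends)\<^sup>*" "d ?w = Suc (d u)"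
      using gdist_pred[OF conn[OF w]] e(2) unfolding d_def by blast
    then obtain e' where e': "e' \<in> E" "ends e' = (u, ?w) \<or> ends e' = (?w, u)"
      unfolding adj_def by blast
    have "fst (ends e') \<in> C"
      using e' w graph_component_edge_iff[OF ok C e'(1)] by auto
    then have "e' \<in> F"
      using e'(1) unfolding F_def by blast
    \<comment> \<open>The ends of \<open>e'\<close> have different distances, so its orientation is
      forced and agrees with the shortest path.\<close>
    moreover have "tail_of ends (e', dir e') = u" "head_of ends (e', dir e') = ?w"
      using e'(2) u(3) unfolding dir_def tail_of_def head_of_def by auto
    ultimately show "\<exists>e'\<in>F. head_of ends (e', dir e') = ?w \<and> d ?w = Suc (d (tail_of ends (e', dir e')))"
      using u(3) by auto
  qed
  then obtain gs where gs: "distinct (map fst gs)" "set gs = (\<lambda>e. (e, dir e)) ` F" "reach ends {c} gs"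
      "tails_reach ends d K c gs"
    by blast
  have "fst ` set gs = F"
    unfolding gs(2) by (auto simp: image_iff)
  moreover have "\<exists>A. finite A \<and> card A \<le> comp_radius E ends C + 1 \<and> c \<in> A \<and>
        Vtx ` A \<subseteq> comp_cake E ends C \<and> reach ends (insert (head_of ends g) A) vs"
    if split: "gs = us @ g # vs" for us g vs
  proof -
    have "g \<in> (\<lambda>e. (e, dir e)) ` F"
      using gs(2) split by auto
    then have "tail_of ends g \<in> C"
      using FC(1) by blast
    then have "d (tail_of ends g) \<le> comp_radius E ends C"
      using c(2) unfolding d_def by blast
    moreover obtain A where "finite A" "card A \<le> Suc (d (tail_of ends g))" "c \<in> A" "A \<subseteq> K"
        "reach ends (insert (head_of ends g) A) vs"
      using tails_reach_split gs(4) split by metis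
    ultimately show ?thesis
      unfolding K_def by (intro exI[of _ A]) auto
  qed
  ultimately show ?thesis
    unfolding dfs_order_def F_def using gs by blast
qed

section \<open>Covering parts of one component\<close>

lemma path_connectedin_opoint:
  assumes "fst g \<in> E" "0 \<le> x" "y \<le> 1"
  shows "path_connectedin (cake_top E ends) (opoint ends g ` {x..y})"
proof -
  let ?flip = "\<lambda>z::real. if snd g then 1 - z else z"
  have "path_connectedin (top_of_set {0..1}) (?flip ` {x..y})"
    using assms(2,3) convex_imp_path_connected[of "{x..y}"] convex_imp_path_connected[of "{1 - y..1 - x}"]
    by (cases "snd g") (auto simp: path_connectedin_subtopology)
  then have "path_connectedin (cake_top E ends) (edge_pt ends (fst g) ` ?flip ` {x..y})"
    by (rule path_connectedin_continuous_map_image[OF continuous_map_edge_pt[OF assms(1)]])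
  then show ?thesis
    unfolding opoint_def image_image .
qed

lemma opoint_in_cake: "fst g \<in> E \<Longrightarrow> 0 \<le> z \<Longrightarrow> z \<le> 1 \<Longrightarrow> opoint ends g z \<in> cake E ends"
  unfolding opoint_def cake_def by (cases "snd g") (auto intro!: bexI[of _ "fst g"])

lemma full_simps [simp]:
  "full ends [] = {}"
  "full ends (g # gs) = opoint ends g ` {0..1} \<union> full ends gs"
  "full ends (us @ vs) = full ends us \<union> full ends vs"
  "full ends (concat gss) = (\<Union>gs\<in>set gss. full ends gs)"
  by (auto simp: full_def)

lemma opoint_image_subset_cake: "fst g \<in> E \<Longrightarrow> 0 \<le> x \<Longrightarrow> y \<le> 1 \<Longrightarrow> opoint ends g ` {x..y} \<subseteq> cake E ends"
  by (intro image_subsetI opoint_in_cake) auto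

lemma full_subset_cake: "fst ` set gs \<subseteq> E \<Longrightarrow> full ends gs \<subseteq> cake E ends"
  unfolding full_def by (intro UN_least opoint_image_subset_cake) auto

lemma Vtx_tail_in: "0 \<le> x \<Longrightarrow> Vtx (tail_of ends g) \<in> opoint ends g ` {0..x}"
  by (metis atLeastAtMost_iff image_eqI opoint_0 order_refl)

lemma Vtx_head_in: "x \<le> 1 \<Longrightarrow> Vtx (head_of ends g) \<in> opoint ends g ` {x..1}"
  by (metis atLeastAtMost_iff image_eqI opoint_1 order_refl)

lemma head_in_full: "g \<in> set gs \<Longrightarrow> Vtx (head_of ends g) \<in> full ends gs"
  unfolding full_def using Vtx_head_in[of 0 ends g] by auto

text \<open>The edges are attached in list order; by the time an edge is due, \<open>reach\<close>
  guarantees that its tail is present.\<close>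

lemma covered_reach:
  assumes "reach ends A gs" "fst ` set gs \<subseteq> E" "covered (cake_top E ends) n P" "Vtx ` A \<subseteq> P"
  shows "covered (cake_top E ends) n (P \<union> full ends gs)"
  using assms
proof (induction gs arbitrary: A P)
  case (Cons g gs)
  have "covered (cake_top E ends) n (P \<union> opoint ends g ` {0..1})"
  proof (rule covered_attach[OF Cons.prems(3)])
    show "path_connectedin (cake_top E ends) (opoint ends g ` {0..1})"
      using Cons.prems(2) by (intro path_connectedin_opoint) auto
    show "P \<inter> opoint ends g ` {0..1} \<noteq> {}"
      using Cons.prems(1,4) Vtx_tail_in[of 1 ends g] by auto
  qed
  then have "covered (cake_top E ends) n (P \<union> opoint ends g ` {0..1} \<union> full ends gs)"
  proof (rule Cons.IH[rotated 2])
    show "reach ends (insert (head_of ends g) A) gs"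
      using Cons.prems(1) by simp
    show "Vtx ` insert (head_of ends g) A \<subseteq> P \<union> opoint ends g ` {0..1}"
      using Cons.prems(4) Vtx_head_in[of 0 ends g] by auto
  qed (use Cons.prems(2) in auto)
  then show ?case
    by (simp add: Un_assoc)
qed simp

text \<open>A cut through the last edge is harmless, because the part kept is the one that contains
  its tail.\<close>

lemma covered_reach_partial:
  assumes "reach ends A (us @ h # vs)" "fst ` set us \<subseteq> E" "fst h \<in> E"
    and "covered (cake_top E ends) n P" "Vtx ` A \<subseteq> P" "0 \<le> y" "y \<le> 1"
  shows "covered (cake_top E ends) n (P \<union> full ends us \<union> opoint ends h ` {0..y})"
proof (rule covered_attach)
  have "tail_of ends h \<in> A \<union> head_of ends ` set us"
    using assms(1) by (simp add: reach_append)
  then have "Vtx (tail_of ends h) \<in> P \<union> full ends us"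
    using assms(5) head_in_full[of _ us ends] by auto
  then show "(P \<union> full ends us) \<inter> opoint ends h ` {0..y} \<noteq> {}"
    using Vtx_tail_in[OF assms(6), of ends h] by blast
  show "covered (cake_top E ends) n (P \<union> full ends us)"
    using assms(1) by (intro covered_reach[OF _ assms(2,4,5)]) (simp add: reach_append)
  show "path_connectedin (cake_top E ends) (opoint ends h ` {0..y})"
    using assms by (intro path_connectedin_opoint) auto
qed

text \<open>The construction grows from the single point \<open>c\<close>, which belongs to the
  prefix because the first edge of the list can only start there. The second claim is what later
  merges the prefix with a stretch whose ancestors include \<open>c\<close>.\<close>

lemma prefix_connected:
  assumes "reach ends {c} (us @ g # vs)" "fst ` set us \<subseteq> E" "fst g \<in> E" "0 \<le> x" "x \<le> 1"
  shows "covered (cake_top E ends) 1 (full ends us \<union> opoint ends g ` {0..x})"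
    and "Vtx c \<in> full ends us \<union> opoint ends g ` {0..x}"
proof -
  show c: "Vtx c \<in> full ends us \<union> opoint ends g ` {0..x}"
  proof (cases us)
    case Nil
    then show ?thesis
      using assms(1) Vtx_tail_in[OF assms(4), of ends g] by simp
  next
    case (Cons u us')
    then show ?thesis
      using assms(1) Vtx_tail_in[of 1 ends u] by simp
  qed
  have "full ends us \<union> opoint ends g ` {0..x} \<subseteq> cake E ends"
    by (intro Un_least full_subset_cake opoint_image_subset_cake assms) simp
  then have "covered (cake_top E ends) 1 {Vtx c}"
    using c by (intro covered_path_connectedin) auto
  then have "covered (cake_top E ends) 1 ({Vtx c} \<union> full ends us \<union> opoint ends g ` {0..x})"
    by (rule covered_reach_partial[OF assms(1-3)]) (use assms in auto)
  moreover have "{Vtx c} \<union> full ends us \<union> opoint ends g ` {0..x} = full ends us \<union> opoint ends g ` {0..x}"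
    using c by blast
  ultimately show "covered (cake_top E ends) 1 (full ends us \<union> opoint ends g ` {0..x})"
    by simp
qed

text \<open>The worst case, in which no two ancestors are joined and none meets the rest of the cut
  edge. With at most \<open>r + 1\<close> ancestors it yields the \<open>r + 2\<close> of the
  theorem.\<close>

lemma covered_vertices_and_edge:
  assumes "finite A" "Vtx ` A \<subseteq> cake E ends" "fst g \<in> E" "0 \<le> x"
  shows "covered (cake_top E ends) (card A + 1) (Vtx ` A \<union> opoint ends g ` {x..1})"
proof (rule covered_Un)
  have "covered (cake_top E ends) (card A) (\<Union>v\<in>A. {Vtx v})"
    using assms(1,2) by (intro covered_UN covered_path_connectedin) auto
  then show "covered (cake_top E ends) (card A) (Vtx ` A)"
    by (simp add: UNION_singleton_eq_range)
  show "covered (cake_top E ends) 1 (opoint ends g ` {x..1})"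
    using assms by (intro covered_path_connectedin path_connectedin_opoint) auto
qed

lemma covered_1_path_connectedin:
  assumes "covered X 1 P"
  shows "path_connectedin X P"
proof -
  obtain \<S> where S: "finite \<S>" "card \<S> \<le> 1" "P = \<Union>\<S>" "\<forall>S\<in>\<S>. path_connectedin X S"
    using assms unfolding covered_def by blast
  have "\<S> = {} \<or> (\<exists>S. \<S> = {S})"
    using S(1,2) card_1_singletonE[of \<S>] by (cases "card \<S>") auto
  then show ?thesis
    using S(3,4) by auto
qed

lemma comp_cake_full:
  assumes "dfs_order E ends C c gs"
  shows "comp_cake E ends C = full ends gs"
proof -
  have "opoint ends g ` {0..1} = edge_pt ends (fst g) ` {0..1}" for g :: "'a \<times> bool"
  proof -
    have "opoint ends g ` {0..1} = edge_pt ends (fst g) ` (\<lambda>z. if snd g then 1 - z else z) ` {0..1}"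
      unfolding opoint_def image_image ..
    also have "(\<lambda>z. if snd g then 1 - z else z) ` {0..1::real} = {0..1}"
      by (cases "snd g") auto
    finally show ?thesis .
  qed
  then have "full ends gs = (\<Union>e\<in>fst ` set gs. edge_pt ends e ` {0..1})"
    unfolding full_def by simp
  then show ?thesis
    using assms unfolding comp_cake_def dfs_order_def by simp
qed

lemma comp_cake_connected:
  assumes "dfs_order E ends C c gs"
  shows "covered (cake_top E ends) 1 (comp_cake E ends C)"
proof (cases gs rule: rev_cases)
  case Nil
  then show ?thesis
    using covered_mono[OF covered_empty] comp_cake_full[OF assms] by simp
next
  case (snoc us g)
  have E: "fst ` set us \<subseteq> E" "fst g \<in> E" "reach ends {c} (us @ g # [])"
    using assms unfolding snoc dfs_order_def by auto
  show ?thesis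
    using prefix_connected(1)[OF E(3,1,2), of 1] unfolding comp_cake_full[OF assms] snoc by simp
qed

text \<open>Adding to a part of a depth-first ordering the at most \<open>r + 1\<close> ancestors of its first edge
  leaves the part with at most \<open>r + 2\<close> components, since every later edge hangs off an ancestor or
  off an earlier edge of the part.  A prefix of the ordering contains the root, hence costs
  nothing.\<close>

lemma cut_component:
  assumes dfs: "dfs_order E ends C c (us @ g # vs)"
  shows "\<exists>A. finite A \<and> Vtx ` A \<subseteq> comp_cake E ends C \<and>
    (\<forall>x. 0 \<le> x \<longrightarrow> x \<le> 1 \<longrightarrow>
      covered (cake_top E ends) (comp_radius E ends C + 2) (Vtx ` A \<union> opoint ends g ` {x..1} \<union> full ends vs)) \<and>
    (\<forall>ws h zs x y. vs = ws @ h # zs \<longrightarrow> 0 \<le> x \<longrightarrow> x \<le> 1 \<longrightarrow> 0 \<le> y \<longrightarrow> y \<le> 1 \<longrightarrow>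
      covered (cake_top E ends) (comp_radius E ends C + 2)
        (Vtx ` A \<union> opoint ends g ` {x..1} \<union> full ends ws \<union> opoint ends h ` {0..y})) \<and>
    (\<forall>x Q. 0 \<le> x \<longrightarrow> x \<le> 1 \<longrightarrow> covered (cake_top E ends) 1 Q \<longrightarrow> Vtx c \<in> Q \<longrightarrow>
      covered (cake_top E ends) (comp_radius E ends C + 2) (Vtx ` A \<union> opoint ends g ` {x..1} \<union> full ends vs \<union> Q))"
proof -
  have E: "fst ` set us \<subseteq> E" "fst ` set vs \<subseteq> E" "fst g \<in> E"
    using dfs unfolding dfs_order_def by auto
  obtain A where A: "finite A" "card A \<le> comp_radius E ends C + 1" "c \<in> A" "Vtx ` A \<subseteq> comp_cake E ends C"
      "reach ends (insert (head_of ends g) A) vs"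
    using dfs unfolding dfs_order_def by blast
  have cake: "Vtx ` A \<subseteq> cake E ends"
    using A(4) unfolding comp_cake_def cake_def by blast
  have base: "covered (cake_top E ends) (comp_radius E ends C + 2) (Vtx ` A \<union> opoint ends g ` {x..1})"
    if "0 \<le> x" for x
    by (rule covered_mono[OF covered_vertices_and_edge[OF A(1) cake E(3) that]]) (use A(2) in simp)
  \<comment> \<open>Whatever the cut, the remainder of the edge contains its head; for
    \<open>x = 1\<close> it is just that vertex.\<close>
  have sub: "Vtx ` insert (head_of ends g) A \<subseteq> Vtx ` A \<union> opoint ends g ` {x..1}" if "x \<le> 1" for x
    using Vtx_head_in[OF that, of ends g] by auto
  have up: "covered (cake_top E ends) (comp_radius E ends C + 2) (Vtx ` A \<union> opoint ends g ` {x..1} \<union> full ends vs)"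
    if "0 \<le> x" "x \<le> 1" for x
    using covered_reach[OF A(5) E(2) base[OF that(1)] sub[OF that(2)]] .
  show ?thesis
  proof (intro exI[of _ A] conjI allI impI A(1,4) up; assumption?)
    fix ws h zs and x y :: real
    assume vs: "vs = ws @ h # zs" and xy: "0 \<le> x" "x \<le> 1" "0 \<le> y" "y \<le> 1"
    show "covered (cake_top E ends) (comp_radius E ends C + 2)
        (Vtx ` A \<union> opoint ends g ` {x..1} \<union> full ends ws \<union> opoint ends h ` {0..y})"
      by (rule covered_reach_partial[OF A(5)[unfolded vs] _ _ base[OF xy(1)] sub[OF xy(2)] xy(3,4)])
        (use E(2) vs in auto)
  next
    \<comment> \<open>The root lies in both \<open>A\<close> and \<open>Q\<close>, so
      \<open>Q\<close> joins a component that has already been counted.\<close>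
    fix x :: real and Q
    assume x: "0 \<le> x" "x \<le> 1" and Q: "covered (cake_top E ends) 1 Q" "Vtx c \<in> Q"
    show "covered (cake_top E ends) (comp_radius E ends C + 2)
        (Vtx ` A \<union> opoint ends g ` {x..1} \<union> full ends vs \<union> Q)"
      by (rule covered_attach[OF up[OF x] covered_1_path_connectedin[OF Q(1)]]) (use Q(2) A(3) in blast)
  qed
qed

section \<open>Two measures on a segment\<close>

text \<open>In the coordinate \<open>(FA + FB) / 2\<close> the half difference \<open>h\<close> of the two distribution functions is a
  continuous function on the circle.  At a maximum of \<open>h\<close> the increment over an arc of length \<open>t\<close>
  is at most zero, at a minimum it is at least zero, so it vanishes somewhere.\<close>

lemma periodic_chord:
  fixes h :: "real \<Rightarrow> real"
  assumes cont: "continuous_on {0..1} h" and h01: "h 0 = h 1" and t: "0 \<le> t" "t \<le> 1"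
  shows "\<exists>a b. 0 \<le> a \<and> a \<le> b \<and> b \<le> 1 \<and> h a = h b \<and> (b - a = t \<or> b - a = 1 - t)"
proof -
  \<comment> \<open>Continues \<open>h\<close> around the circle once more, so that an arc through
    the base point becomes an ordinary interval.\<close>
  define k where "k = (\<lambda>x. if x \<le> 1 then h x else h (x - 1))"
  have k_cont: "continuous_on {0..2} k"
  proof -
    have "continuous_on ({0..1} \<union> {1..2}) (\<lambda>x. if x \<le> 1 then h x else h (x - 1))"
    proof (rule continuous_on_If)
      show "continuous_on {1..2} (\<lambda>x. h (x - 1))"
        by (rule continuous_on_compose2[OF cont]) (auto intro!: continuous_intros)
    qed (use cont h01 in auto)
    moreover have "{0..1} \<union> {1..2} = {0..2::real}"
      by auto
    ultimately show ?thesis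
      unfolding k_def by simp
  qed
  obtain p where p: "p \<in> {0..1}" "\<And>x. x \<in> {0..1} \<Longrightarrow> h x \<le> h p"
    using continuous_attains_sup[OF _ _ cont] by auto
  obtain q where q: "q \<in> {0..1}" "\<And>x. x \<in> {0..1} \<Longrightarrow> h q \<le> h x"
    using continuous_attains_inf[OF _ _ cont] by auto
  define g where "g = (\<lambda>x. k (x + t) - k x)"
  have "continuous_on {0..1} (\<lambda>x. k (x + t))"
    by (rule continuous_on_compose2[OF k_cont]) (use t in \<open>auto intro!: continuous_intros\<close>)
  moreover have "continuous_on {0..1} k"
    using k_cont by (rule continuous_on_subset) auto
  ultimately have g_cont: "continuous_on {0..1} g"
    unfolding g_def by (rule continuous_on_diff)
  have k_range: "\<exists>y\<in>{0..1}. k x = h y" if "0 \<le> x" "x \<le> 2" for x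
  proof (cases "x \<le> 1")
    case True
    then show ?thesis
      using that unfolding k_def by auto
  next
    case False
    then show ?thesis
      using that unfolding k_def by (intro bexI[of _ "x - 1"]) auto
  qed
  have "g p \<le> 0"
    using k_range[of "p + t"] p t unfolding g_def by (auto simp: k_def)
  moreover have "0 \<le> g q"
    using k_range[of "q + t"] q t unfolding g_def by (auto simp: k_def)
  ultimately have "\<exists>x\<in>{0..1}. g x = 0"
  proof -
    \<comment> \<open>Connectedness of the image is used because \<open>p\<close> and
      \<open>q\<close> may come in either order.\<close>
    have "connected (g ` {0..1})"
      using g_cont by (rule connected_continuous_image) simp
    then have "0 \<in> g ` {0..1}"
      using connectedD_interval[of "g ` {0..1}" "g p" "g q" 0] \<open>g p \<le> 0\<close> \<open>0 \<le> g q\<close> p(1) q(1) by auto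
    then show ?thesis
      by force
  qed
  then obtain x where x: "0 \<le> x" "x \<le> 1" "k (x + t) = k x"
    unfolding g_def by auto
  show ?thesis
  proof (cases "x + t \<le> 1")
    case True
    then show ?thesis
      using x t by (intro exI[of _ x] exI[of _ "x + t"]) (auto simp: k_def)
  next
    \<comment> \<open>The arc wraps around; its complement is an interval of length
      \<open>1 - t\<close> with equal values of \<open>h\<close> at its ends.\<close>
    case False
    then show ?thesis
      using x t by (intro exI[of _ "x + t - 1"] exI[of _ x]) (auto simp: k_def)
  qed
qed

text \<open>In the coordinate \<open>G\<close> the length of an interval is the mean of its two
  values, and equal values of \<open>h\<close> at its ends say that the two agree; both are then the
  length. The alternative \<open>1 - t\<close> stands for an arc through the base point, represented
  by its complement.\<close>

lemma common_interval:
  fixes FA FB :: "real \<Rightarrow> real" and m t :: real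
  assumes m: "0 \<le> m" and cont: "continuous_on {0..m} FA" "continuous_on {0..m} FB"
    and mono: "mono FA" "mono FB" and 0: "FA 0 = 0" "FB 0 = 0" and 1: "FA m = 1" "FB m = 1"
    and t: "0 \<le> t" "t \<le> 1"
  shows "\<exists>a b. 0 \<le> a \<and> a \<le> b \<and> b \<le> m \<and>
    ((FA b - FA a = t \<and> FB b - FB a = t) \<or> (FA b - FA a = 1 - t \<and> FB b - FB a = 1 - t))"
proof -
  define G where "G = (\<lambda>x. (FA x + FB x) / 2)"
  have "continuous_on {0..m} G"
    unfolding G_def using cont by (intro continuous_intros) auto
  then have "\<exists>x\<ge>0. x \<le> m \<and> G x = y" if "y \<in> {0..1}" for y
    using that m 0 1 by (intro IVT') (auto simp: G_def)
  \<comment> \<open>\<open>c\<close> is an arbitrary right inverse of \<open>G\<close>, possibly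
    discontinuous where \<open>G\<close> has flat stretches. The next estimate shows that
    \<open>h\<close> does not depend on the choice.\<close>
  then obtain c where c: "\<And>y. y \<in> {0..1} \<Longrightarrow> 0 \<le> c y \<and> c y \<le> m \<and> G (c y) = y"
    by (metis (no_types))
  define h where "h = (\<lambda>y. (FA (c y) - FB (c y)) / 2)"
  \<comment> \<open>By monotonicity the increments of \<open>FA\<close> and \<open>FB\<close> have
    the same sign, so their difference is at most their sum in absolute value.\<close>
  have diff: "\<bar>(FA u - FB u) / 2 - (FA v - FB v) / 2\<bar> \<le> \<bar>G u - G v\<bar>" for u v
  proof (cases "u \<le> v")
    case True
    then show ?thesis
      using monoD[OF mono(1) True] monoD[OF mono(2) True] unfolding G_def by (simp add: abs_if field_simps)
  next
    case False
    then have "v \<le> u" by simp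
    from monoD[OF mono(1) this] monoD[OF mono(2) this] show ?thesis
      unfolding G_def by (simp add: abs_if field_simps)
  qed
  have lip: "\<bar>h y - h z\<bar> \<le> \<bar>y - z\<bar>" if "y \<in> {0..1}" "z \<in> {0..1}" for y z
    using diff[of "c y" "c z"] c[OF that(1)] c[OF that(2)] unfolding h_def by simp
  have "continuous_on {0..1} h"
    unfolding continuous_on_iff
  proof (intro ballI allI impI)
    fix y e :: real assume y: "y \<in> {0..1}" "0 < e"
    show "\<exists>d>0. \<forall>x'\<in>{0..1}. dist x' y < d \<longrightarrow> dist (h x') (h y) < e"
    proof (intro exI[of _ e] conjI ballI impI y(2))
      fix z assume "z \<in> {0..1}" "dist z y < e"
      then show "dist (h z) (h y) < e"
        using lip[of z y] y(1) unfolding dist_real_def by linarith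
    qed
  qed
  moreover have "h 0 = h 1"
  proof -
    \<comment> \<open>\<open>c 0\<close> need not be 0 and \<open>c 1\<close> need not be
      \<open>m\<close>, but \<open>G\<close> takes the same values there, and by \<open>diff\<close>
      so does the half difference.\<close>
    have "G (c 0) = G 0" "G (c 1) = G m"
      using c[of 0] c[of 1] 0 1 unfolding G_def by auto
    then have "\<bar>(FA (c 0) - FB (c 0)) / 2 - (FA 0 - FB 0) / 2\<bar> \<le> 0"
      "\<bar>(FA (c 1) - FB (c 1)) / 2 - (FA m - FB m) / 2\<bar> \<le> 0"
      using diff[of "c 0" 0] diff[of "c 1" m] by auto
    then show ?thesis
      unfolding h_def using 0 1 by simp
  qed
  ultimately obtain a b where ab: "0 \<le> a" "a \<le> b" "b \<le> 1" "h a = h b" "b - a = t \<or> b - a = 1 - t"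
    using periodic_chord t by blast
  have ca: "0 \<le> c a" "c a \<le> m" "G (c a) = a" and cb: "0 \<le> c b" "c b \<le> m" "G (c b) = b"
    using c[of a] c[of b] ab by auto
  have arith: "x - u = w \<and> y - v = w" if "(x + y) - (u + v) = 2 * w" "x - y = u - v" for x y u v w :: real
    using that by auto
  have sum: "(FA (c b) + FB (c b)) - (FA (c a) + FB (c a)) = 2 * (b - a)"
    using ca(3) cb(3) unfolding G_def by (simp add: field_simps)
  have dif: "FA (c b) - FB (c b) = FA (c a) - FB (c a)"
    using ab(4) unfolding h_def by simp
  have eqA: "FA (c b) - FA (c a) = b - a"
    using arith[OF sum dif] by simp
  have eqB: "FB (c b) - FB (c a) = b - a"
    using arith[OF sum dif] by simp
  show ?thesis
  proof (cases "c a \<le> c b")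
    case True
    then show ?thesis
      using ca cb eqA eqB ab(5) by (intro exI[of _ "c a"] exI[of _ "c b"]) auto
  next
    \<comment> \<open>\<open>c\<close> can reverse the order only if \<open>a = b\<close>; then the
      required value is 0 and a degenerate interval has it.\<close>
    case False
    then have "FA (c b) \<le> FA (c a)"
      using mono(1) by (simp add: monoD)
    then have "b - a = 0"
      using eqA ab(2) by linarith
    then show ?thesis
      using ca ab(5) by (intro exI[of _ "c a"] exI[of _ "c a"]) auto
  qed
qed

section \<open>Valuations along a list of edges\<close>

text \<open>The list lays the edges one after the other on a segment; vertices get the junk
  position \<open>-1\<close>.\<close>

definition pos :: "('e \<times> bool) list \<Rightarrow> ('v, 'e) cpt \<Rightarrow> real" where
  "pos L q = (case q of Vtx v \<Rightarrow> -1
    | Inner e z \<Rightarrow> (let n = (SOME n. n < length L \<and> fst (L ! n) = e)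
                    in real n + (if snd (L ! n) then 1 - z else z)))"

definition edge_list :: "'e set \<Rightarrow> ('e \<times> bool) list \<Rightarrow> bool" where
  "edge_list E L \<longleftrightarrow> distinct (map fst L) \<and> fst ` set L = E"

lemma pos_Vtx [simp]: "pos L (Vtx v) = -1"
  by (simp add: pos_def)

lemma pos_Inner:
  assumes "edge_list E L" "n < length L"
  shows "pos L (Inner (fst (L ! n)) z) = real n + (if snd (L ! n) then 1 - z else z)"
proof -
  have "(SOME k. k < length L \<and> fst (L ! k) = fst (L ! n)) = n"
  proof (rule some_equality)
    show "k = n" if "k < length L \<and> fst (L ! k) = fst (L ! n)" for k
      using that assms nth_eq_iff_index_eq[of "map fst L" k n] unfolding edge_list_def by simp
  qed (use assms in simp)
  then show ?thesis
    by (simp add: pos_def)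
qed

lemma pos_opoint:
  assumes "edge_list E L" "n < length L" "0 < z" "z < 1"
  shows "pos L (opoint ends (L ! n) z) = real n + z"
  using assms by (simp add: opoint_inner pos_Inner)

lemma cake_cases:
  assumes "edge_list E L" "q \<in> cake E ends"
  obtains (Vtx) v where "q = Vtx v"
  | (inner) n z where "n < length L" "0 < z" "z < 1" "q = opoint ends (L ! n) z"
proof -
  obtain e x where e: "e \<in> E" "0 \<le> x" "x \<le> 1" "q = edge_pt ends e x"
    using assms(2) unfolding cake_def by auto
  obtain n where n: "n < length L" "fst (L ! n) = e"
    using assms(1) e(1) unfolding edge_list_def by (metis in_set_conv_nth image_iff)
  show thesis
  proof (cases "x = 0 \<or> x = 1")
    case True
    then show thesis
      using e(4) that(1) by (auto simp: edge_pt_def)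
  next
    case False
    then have "q = opoint ends (L ! n) (if snd (L ! n) then 1 - x else x)"
      using e n(2) by (simp add: opoint_def)
    then show thesis
      using that(2)[OF n(1), of "if snd (L ! n) then 1 - x else x"] False e(2,3) by (auto split: if_splits)
  qed
qed

lemma pos_range:
  assumes "edge_list E L" "q \<in> cake E ends"
  shows "pos L q = -1 \<or> (0 < pos L q \<and> pos L q < length L)"
  using assms
proof (cases rule: cake_cases)
  case (inner n z)
  then show ?thesis
    by (simp add: pos_opoint[OF assms(1)])
qed simp

text \<open>For \<open>a \<ge> 0\<close> the junk position is excluded and each edge contributes at
  most one point. This serves twice: for the continuity of the distribution functions and for the
  finiteness of the overlap at the cuts.\<close>

lemma finite_pos_eq:
  assumes "edge_list E L" "0 \<le> a"
  shows "finite {q \<in> cake E ends. pos L q = a}"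
proof (rule finite_subset)
  show "{q \<in> cake E ends. pos L q = a} \<subseteq> (\<lambda>n. opoint ends (L ! n) (a - real n)) ` {..<length L}"
  proof
    fix q assume "q \<in> {q \<in> cake E ends. pos L q = a}"
    then have q: "q \<in> cake E ends" "pos L q = a"
      by auto
    from assms(1) q(1) show "q \<in> (\<lambda>n. opoint ends (L ! n) (a - real n)) ` {..<length L}"
    proof (cases rule: cake_cases)
      case (Vtx v)
      then show ?thesis using q(2) assms(2) by simp
    next
      case (inner n z)
      then have "a - real n = z"
        using pos_opoint[OF assms(1), of n z ends] q(2) by simp
      then show ?thesis
        using inner by auto
    qed
  qed
qed simp

lemma finite_cake_vertices:
  assumes "graph_ok V E ends"
  shows "finite {q \<in> cake E ends. \<exists>v. q = Vtx v}"
proof (rule finite_subset)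
  show "{q \<in> cake E ends. \<exists>v. q = Vtx v} \<subseteq> Vtx ` V"
    using assms unfolding graph_ok_def by (auto simp: Vtx_in_cake_iff)
  show "finite (Vtx ` V)"
    using assms unfolding graph_ok_def by simp
qed

section \<open>Null sets, measurability of the position, and distribution functions\<close>

lemma cake_open_sets:
  assumes "valuation E ends M" "cake_open E ends U"
  shows "U \<in> sets M"
proof -
  have "{U. openin (cake_top E ends) U} \<subseteq> Pow (cake E ends)"
    unfolding openin_cake_top by (intro subsetI[OF PowI] cake_open_subset) (simp only: mem_Collect_eq)
  moreover have "sets M = sets (sigma (cake E ends) {U. openin (cake_top E ends) U})"
    using assms(1) unfolding valuation_def cake_borel_def by (elim conjE)
  ultimately show ?thesis
    using assms(2) by (simp add: sets_measure_of sigma_sets.Basic)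
qed

lemma finite_null_sets:
  assumes M: "valuation E ends M" and X: "finite X" "X \<subseteq> cake E ends"
  shows "X \<in> null_sets M"
proof -
  have "{x} \<in> null_sets M" if "x \<in> X" for x
  proof -
    have x: "x \<in> cake E ends"
      using that X(2) by blast
    have sp: "space M = cake E ends"
      using M unfolding valuation_def by blast
    have "space M - (cake E ends - {x}) \<in> sets M"
      using cake_open_sets[OF M cake_open_minus_singleton] by blast
    moreover have "space M - (cake E ends - {x}) = {x}"
      unfolding sp using x by blast
    ultimately show ?thesis
      using M x unfolding valuation_def by (intro null_setsI) auto
  qed
  then have "(\<Union>x\<in>X. {x}) \<in> null_sets M"
    using X(1) by (intro null_sets_UN') (auto intro: countable_finite)
  then show ?thesis by simp
qed

text \<open>Since the junk value \<open>-1\<close> is below all genuine positions, a superlevel set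
  at a level \<open>y \<ge> -1\<close> contains no vertex and has to be open only inside each edge;
  for smaller \<open>y\<close> it is the whole cake.\<close>

lemma pos_measurable:
  assumes M: "valuation E ends M" and L: "edge_list E L"
  shows "pos L \<in> borel_measurable M"
proof (rule borel_measurableI_greater)
  fix y :: real
  have sp: "space M = cake E ends"
    using M unfolding valuation_def by blast
  have "{q \<in> cake E ends. y < pos L q} \<in> sets M"
  proof (cases "y < -1")
    case True
    then have "{q \<in> cake E ends. y < pos L q} = space M"
      using pos_range[OF L] unfolding sp by force
    then show ?thesis by simp
  next
    case False
    have "cake_open E ends {q \<in> cake E ends. y < pos L q}"
    proof (rule cake_open_without_vertices)
      fix e assume e: "e \<in> E"
      then obtain n where n: "n < length L" "fst (L ! n) = e"
        using L unfolding edge_list_def by (metis in_set_conv_nth image_iff)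
      have "{x. 0 < x \<and> x < 1 \<and> Inner e x \<in> {q \<in> cake E ends. y < pos L q}} =
          {0<..<1} \<inter> {x. y < real n + (if snd (L ! n) then 1 - x else x)}"
        using e unfolding n(2)[symmetric] by (auto simp: Inner_in_cake_iff pos_Inner[OF L n(1)])
      moreover have "open ({0<..<1} \<inter> {x. y < real n + (if snd (L ! n) then 1 - x else x)})"
        by (cases "snd (L ! n)") (auto intro!: open_Int open_Collect_less continuous_intros)
      ultimately show "open {x. 0 < x \<and> x < 1 \<and> Inner e x \<in> {q \<in> cake E ends. y < pos L q}}"
        by simp
    qed (use False in auto)
    then show ?thesis
      by (rule cake_open_sets[OF M])
  qed
  then show "{q \<in> space M. y < pos L q} \<in> sets M"
    unfolding sp .
qed

text \<open>Passing through the distribution on the line turns monotonicity and, for null fibres,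
  continuity into standard facts about \<open>cdf\<close>.\<close>

definition pos_cdf :: "('e \<times> bool) list \<Rightarrow> ('v, 'e) cpt measure \<Rightarrow> real \<Rightarrow> real" where
  "pos_cdf L M = cdf (distr M borel (pos L))"

lemma pos_distribution:
  assumes M: "valuation E ends M" and L: "edge_list E L"
  shows "real_distribution (distr M borel (pos L))"
proof -
  interpret prob_space M
    using M unfolding valuation_def by blast
  show ?thesis
    by (rule real_distribution_distr) (rule pos_measurable[OF M L])
qed

lemma pos_cdf_eq:
  assumes M: "valuation E ends M" and L: "edge_list E L"
  shows "pos_cdf L M y = measure M {q \<in> cake E ends. pos L q \<le> y}"
proof -
  have "pos L -` {..y} \<inter> space M = {q \<in> cake E ends. pos L q \<le> y}"
    using M unfolding valuation_def by auto
  then show ?thesis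
    unfolding pos_cdf_def cdf_def by (simp add: measure_distr[OF pos_measurable[OF M L]])
qed

lemma mono_pos_cdf:
  assumes M: "valuation E ends M" and L: "edge_list E L"
  shows "mono (pos_cdf L M)"
proof -
  interpret real_distribution "distr M borel (pos L)"
    by (rule pos_distribution[OF M L])
  show ?thesis
    unfolding pos_cdf_def by (rule monoI) (rule cdf_nondecreasing)
qed

lemma continuous_pos_cdf:
  assumes M: "valuation E ends M" and L: "edge_list E L"
  shows "continuous_on {0..m} (pos_cdf L M)"
proof (rule continuous_at_imp_continuous_on, rule ballI)
  fix a assume a: "a \<in> {0..m}"
  interpret real_distribution "distr M borel (pos L)"
    by (rule pos_distribution[OF M L])
  have "pos L -` {a} \<inter> space M = {q \<in> cake E ends. pos L q = a}"
    using M unfolding valuation_def by auto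
  moreover have "{q \<in> cake E ends. pos L q = a} \<in> null_sets M"
    using finite_pos_eq[OF L] a by (intro finite_null_sets[OF M]) auto
  ultimately have "measure (distr M borel (pos L)) {a} = 0"
    by (simp add: measure_distr[OF pos_measurable[OF M L]] measure_eq_0_null_sets)
  then show "isCont (pos_cdf L M) a"
    unfolding pos_cdf_def by (simp add: isCont_cdf)
qed

text \<open>Only vertices have a position at most 0, and there are finitely many of them.\<close>

lemma pos_cdf_0:
  assumes ok: "graph_ok V E ends" and M: "valuation E ends M" and L: "edge_list E L"
  shows "pos_cdf L M 0 = 0"
proof -
  have "finite {q \<in> cake E ends. pos L q \<le> 0}"
  proof (rule finite_subset[OF _ finite_cake_vertices[OF ok]])
    show "{q \<in> cake E ends. pos L q \<le> 0} \<subseteq> {q \<in> cake E ends. \<exists>v. q = Vtx v}"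
    proof
      fix q assume "q \<in> {q \<in> cake E ends. pos L q \<le> 0}"
      then have q: "q \<in> cake E ends" "pos L q \<le> 0"
        by auto
      from L q(1) show "q \<in> {q \<in> cake E ends. \<exists>v. q = Vtx v}"
      proof (cases rule: cake_cases)
        case (inner n z)
        then show ?thesis
          using pos_opoint[OF L, of n z ends] q(2) by simp
      qed (use q in auto)
    qed
  qed
  then have "{q \<in> cake E ends. pos L q \<le> 0} \<in> null_sets M"
    by (intro finite_null_sets[OF M]) auto
  then show ?thesis
    by (simp add: pos_cdf_eq[OF M L] measure_eq_0_null_sets)
qed

lemma pos_cdf_length:
  assumes M: "valuation E ends M" and L: "edge_list E L"
  shows "pos_cdf L M (length L) = 1"
proof -
  interpret prob_space M
    using M unfolding valuation_def by blast
  have "{q \<in> cake E ends. pos L q \<le> length L} = space M"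
    using pos_range[OF L] M unfolding valuation_def by fastforce
  then show ?thesis
    using prob_space by (simp add: pos_cdf_eq[OF M L])
qed

text \<open>Absorbs all the changes made for the sake of connectedness: added ancestors, shared
  vertices and end points of arcs.\<close>

lemma measure_eq_finite_diff:
  assumes M: "valuation E ends M" and Q: "Q \<in> sets M" and P: "P \<subseteq> cake E ends"
    and fin: "finite (P - Q)" "finite (Q - P)"
  shows "P \<in> sets M" "measure M P = measure M Q"
proof -
  have sp: "space M = cake E ends"
    using M unfolding valuation_def by blast
  have QE: "Q \<subseteq> cake E ends"
    using sets.sets_into_space[OF Q] sp by simp
  have N: "P - Q \<in> null_sets M" "Q - P \<in> null_sets M"
    using fin P QE by (intro finite_null_sets[OF M]; auto)+
  have eq: "P = (Q - (Q - P)) \<union> (P - Q)"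
    by blast
  have QP: "Q - (Q - P) \<in> sets M"
    by (rule sets.Diff[OF Q null_setsD2[OF N(2)]])
  show "P \<in> sets M"
    by (subst eq) (rule sets.Un[OF QP null_setsD2[OF N(1)]])
  have "measure M ((Q - (Q - P)) \<union> (P - Q)) = measure M (Q - (Q - P))"
    by (rule measure_Un_null_set[OF QP N(1)])
  also have "\<dots> = measure M Q"
    by (rule measure_Diff_null_set[OF Q N(2)])
  finally show "measure M P = measure M Q"
    using eq by simp
qed

text \<open>Which vertices belong to \<open>P\<close> is left open on purpose. Compared with the
  positions in the half-open interval from \<open>a\<close> to \<open>b\<close>, \<open>P\<close>
  gains at most vertices and points at \<open>a\<close>; it loses nothing, because a position above
  \<open>a \<ge> 0\<close> is never that of a vertex.\<close>

lemma measure_between_cuts: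
  assumes ok: "graph_ok V E ends" and M: "valuation E ends M" and L: "edge_list E L"
    and ab: "0 \<le> a" "a \<le> b"
    and P: "P \<subseteq> cake E ends" "\<And>q. q \<in> cake E ends \<Longrightarrow> \<forall>v. q \<noteq> Vtx v \<Longrightarrow> q \<in> P \<longleftrightarrow> a \<le> pos L q \<and> pos L q \<le> b"
  shows "P \<in> sets M" "measure M P = pos_cdf L M b - pos_cdf L M a"
proof -
  interpret prob_space M
    using M unfolding valuation_def by blast
  have sp: "space M = cake E ends"
    using M unfolding valuation_def by blast
  let ?S = "\<lambda>y. {q \<in> cake E ends. pos L q \<le> y}"
  have S: "?S y \<in> sets M" for y
    using pos_measurable[OF M L, THEN borel_measurable_le[OF _ borel_measurable_const, of _ _ y]]
    unfolding sp by simp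
  have sub: "?S a \<subseteq> ?S b"
    using ab by auto
  have "P - (?S b - ?S a) \<subseteq> {q \<in> cake E ends. \<exists>v. q = Vtx v} \<union> {q \<in> cake E ends. pos L q = a}"
  proof
    fix q assume q: "q \<in> P - (?S b - ?S a)"
    then have "q \<in> cake E ends"
      using P(1) by auto
    then show "q \<in> {q \<in> cake E ends. \<exists>v. q = Vtx v} \<union> {q \<in> cake E ends. pos L q = a}"
      using q P(2)[of q] by (cases "\<exists>v. q = Vtx v") auto
  qed
  then have 1: "finite (P - (?S b - ?S a))"
    by (rule finite_subset) (use finite_cake_vertices[OF ok] finite_pos_eq[OF L ab(1)] in auto)
  have "(?S b - ?S a) - P = {}"
  proof -
    have "q \<in> P" if q: "q \<in> cake E ends" "\<not> pos L q \<le> a" "pos L q \<le> b" for q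
    proof -
      have "\<forall>v. q \<noteq> Vtx v"
        using q(2) ab(1) by auto
      then show ?thesis
        using P(2)[OF q(1)] q(2,3) by simp
    qed
    then show ?thesis by auto
  qed
  then have 2: "finite ((?S b - ?S a) - P)"
    by (simp only: finite.emptyI)
  have Q: "?S b - ?S a \<in> sets M"
    by (rule sets.Diff[OF S S])
  show "P \<in> sets M" "measure M P = pos_cdf L M b - pos_cdf L M a"
    using measure_eq_finite_diff[OF M Q P(1) 1 2] finite_measure_Diff[OF S S sub]
    by (simp_all add: pos_cdf_eq[OF M L])
qed

section \<open>Divisions by two cuts\<close>

lemma piece_Un:
  assumes "piece E ends P" "piece E ends Q"
  shows "piece E ends (P \<union> Q)"
proof -
  obtain F where F: "finite F" "\<forall>(e, I)\<in>F. e \<in> E \<and> I \<subseteq> {0..1} \<and> is_interval I"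
      "P = (\<Union>(e, I)\<in>F. edge_pt ends e ` I)"
    using assms(1) unfolding piece_def by blast
  obtain F' where F': "finite F'" "\<forall>(e, I)\<in>F'. e \<in> E \<and> I \<subseteq> {0..1} \<and> is_interval I"
      "Q = (\<Union>(e, I)\<in>F'. edge_pt ends e ` I)"
    using assms(2) unfolding piece_def by blast
  show ?thesis
    unfolding piece_def
  proof (intro exI[of _ "F \<union> F'"] conjI)
    show "finite (F \<union> F')"
      using F(1) F'(1) by (rule finite_UnI)
    show "\<forall>(e, I)\<in>F \<union> F'. e \<in> E \<and> I \<subseteq> {0..1} \<and> is_interval I"
      using F(2) F'(2) by (simp only: ball_Un)
    show "P \<union> Q = (\<Union>(e, I)\<in>F \<union> F'. edge_pt ends e ` I)"
      unfolding F(3) F'(3) by (simp only: UN_Un)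
  qed
qed

lemma piece_empty: "piece E ends {}"
  unfolding piece_def by (intro exI[of _ "{}"]) simp

lemma piece_interval: "e \<in> E \<Longrightarrow> I \<subseteq> {0..1} \<Longrightarrow> is_interval I \<Longrightarrow> piece E ends (edge_pt ends e ` I)"
  unfolding piece_def by (intro exI[of _ "{(e, I)}"]) simp

lemma piece_opoint:
  assumes "fst g \<in> E" "0 \<le> x" "y \<le> 1"
  shows "piece E ends (opoint ends g ` {x..y})"
proof (cases "snd g")
  case True
  then have "opoint ends g ` {x..y} = edge_pt ends (fst g) ` (\<lambda>z. 1 - z) ` {x..y}"
    unfolding opoint_def image_image by simp
  also have "(\<lambda>z. 1 - z) ` {x..y} = {1 - y..1 - x}"
    by simp
  finally show ?thesis
    using assms by (auto intro!: piece_interval is_interval_cc)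
next
  case False
  then have "opoint ends g ` {x..y} = edge_pt ends (fst g) ` {x..y}"
    unfolding opoint_def by simp
  then show ?thesis
    using assms by (auto intro!: piece_interval is_interval_cc)
qed

lemma piece_full: "fst ` set gs \<subseteq> E \<Longrightarrow> piece E ends (full ends gs)"
  by (induction gs) (auto intro!: piece_empty piece_Un piece_opoint)

lemma piece_vertices:
  assumes "finite A" "Vtx ` A \<subseteq> cake E ends"
  shows "piece E ends (Vtx ` A)"
  using assms
proof (induction A)
  case (insert v A)
  then obtain e where e: "e \<in> E" "v = fst (ends e) \<or> v = snd (ends e)"
    using Vtx_in_cake_iff[of v E ends] by auto
  have "piece E ends (edge_pt ends e ` {0})" "piece E ends (edge_pt ends e ` {1})"
    using piece_interval[OF e(1), of "{0}"] piece_interval[OF e(1), of "{1}"] by (simp_all add: is_interval_1)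
  then have "piece E ends {Vtx v}"
    using e(2) by (auto simp: edge_pt_def)
  then show ?case
    using piece_Un[of E ends "{Vtx v}" "Vtx ` A"] insert by simp
qed (simp add: piece_empty)

section \<open>Interior points of edges and their places in the list\<close>

lemma inner_mem_opoint:
  assumes L: "edge_list E L" "n < length L" "k < length L" and z: "0 < z" "z < 1" and I: "I \<subseteq> {0..1}"
  shows "opoint ends (L ! n) z \<in> opoint ends (L ! k) ` I \<longleftrightarrow> n = k \<and> z \<in> I"
proof
  assume "opoint ends (L ! n) z \<in> opoint ends (L ! k) ` I"
  then obtain z' where z': "z' \<in> I" "opoint ends (L ! n) z = opoint ends (L ! k) z'"
    by blast
  have "z' \<noteq> 0" "z' \<noteq> 1"
    using z'(2) z by (auto simp: opoint_inner)
  moreover have "0 \<le> z'" "z' \<le> 1"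
    using z'(1) I by auto
  ultimately have eq: "fst (L ! n) = fst (L ! k)" "(if snd (L ! n) then 1 - z else z) = (if snd (L ! k) then 1 - z' else z')"
    using z'(2) z by (simp_all add: opoint_inner)
  have "n = k"
    using eq(1) L nth_eq_iff_index_eq[of "map fst L" n k] unfolding edge_list_def by simp
  moreover from this have "z = z'"
    using eq(2) by (auto split: if_splits)
  ultimately show "n = k \<and> z \<in> I"
    using z'(1) by simp
qed blast

lemma nth_mem_middle:
  assumes "distinct (us @ ws @ vs)" "n < length (us @ ws @ vs)"
  shows "(us @ ws @ vs) ! n \<in> set ws \<longleftrightarrow> length us \<le> n \<and> n < length us + length ws"
proof -
  consider "n < length us" | "length us \<le> n" "n < length us + length ws" | "length us + length ws \<le> n"
    by linarith
  then show ?thesis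
  proof cases
    case 1
    have "us ! n \<notin> set ws"
      using nth_mem[OF 1] assms(1) unfolding distinct_append set_append by blast
    then show ?thesis
      using 1 by (simp add: nth_append)
  next
    case 2
    then have "n - length us < length ws" by linarith
    then show ?thesis
      using 2 by (simp add: nth_append)
  next
    case 3
    then have "vs ! (n - length us - length ws) \<in> set vs"
      using assms(2) by simp
    then have "vs ! (n - length us - length ws) \<notin> set ws"
      using assms(1) unfolding distinct_append set_append by blast
    then show ?thesis
      using 3 by (simp add: nth_append)
  qed
qed

lemma inner_mem_full:
  assumes L: "edge_list E (us @ ws @ vs)" "n < length (us @ ws @ vs)" and z: "0 < z" "z < 1"
  shows "opoint ends ((us @ ws @ vs) ! n) z \<in> full ends ws \<longleftrightarrow> length us \<le> n \<and> n < length us + length ws"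
proof -
  let ?L = "us @ ws @ vs"
  have "distinct ?L"
    using L(1) unfolding edge_list_def by (metis distinct_map)
  then have iff: "?L ! n \<in> set ws \<longleftrightarrow> length us \<le> n \<and> n < length us + length ws"
    using L(2) by (rule nth_mem_middle)
  have "opoint ends (?L ! n) z \<in> full ends ws \<longleftrightarrow> ?L ! n \<in> set ws"
  proof
    assume "opoint ends (?L ! n) z \<in> full ends ws"
    then obtain g where g: "g \<in> set ws" "opoint ends (?L ! n) z \<in> opoint ends g ` {0..1}"
      unfolding full_def by blast
    then have "g \<in> set ?L" by simp
    then obtain k where "k < length ?L" "g = ?L ! k"
      unfolding in_set_conv_nth by blast
    then have "g = ?L ! n"
      using g(2) inner_mem_opoint[OF L, of k z "{0..1}" ends] z by simp
    then show "?L ! n \<in> set ws"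
      using g(1) by simp
  next
    assume "?L ! n \<in> set ws"
    moreover have "opoint ends (?L ! n) z \<in> opoint ends (?L ! n) ` {0..1}"
      by (rule imageI) (use z in simp)
    ultimately show "opoint ends (?L ! n) z \<in> full ends ws"
      unfolding full_def by blast
  qed
  then show ?thesis
    using iff by simp
qed

lemma not_inner_Vtx: "0 < z \<Longrightarrow> z < 1 \<Longrightarrow> opoint ends g z \<notin> Vtx ` A"
  by (auto simp: opoint_inner)

lemma cake_eq_full: "edge_list E L \<Longrightarrow> cake E ends = full ends L"
proof -
  assume L: "edge_list E L"
  have "full ends L \<subseteq> cake E ends"
    using L by (intro full_subset_cake) (simp add: edge_list_def)
  moreover have "cake E ends \<subseteq> full ends L"
  proof
    fix q assume "q \<in> cake E ends"
    then obtain e x where e: "e \<in> E" "0 \<le> x" "x \<le> 1" "q = edge_pt ends e x"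
      unfolding cake_def by auto
    obtain g where g: "g \<in> set L" "fst g = e"
      using L e(1) unfolding edge_list_def by blast
    have "q = opoint ends g (if snd g then 1 - x else x)"
      using e(4) g(2) by (simp add: opoint_def)
    moreover have "(if snd g then 1 - x else x) \<in> {0..1}"
      using e(2,3) by simp
    ultimately show "q \<in> full ends L"
      unfolding full_def using g(1) by blast
  qed
  ultimately show ?thesis by blast
qed

text \<open>Vertices are exempt, since their position is junk and pieces are enlarged by ancestors;
  being finite in number they do not affect a valuation.\<close>

definition between_cuts ::
  "'e set \<Rightarrow> ('e \<Rightarrow> 'v \<times> 'v) \<Rightarrow> ('e \<times> bool) list \<Rightarrow> real \<Rightarrow> real \<Rightarrow> ('v, 'e) cpt set \<Rightarrow> bool" where
  "between_cuts E ends L a b \<alpha> \<longleftrightarrow>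
     (\<forall>q\<in>cake E ends. (\<forall>v. q \<noteq> Vtx v) \<longrightarrow> q \<in> \<alpha> \<longleftrightarrow> a \<le> pos L q \<and> pos L q \<le> b)"

text \<open>Reduces a division to arithmetic with \<open>n + z\<close>. A common point that is not a
  vertex must sit exactly at one of the two cut positions.\<close>

lemma divisionI:
  assumes ok: "graph_ok V E ends" and L: "edge_list E L"
    and pieces: "piece E ends \<alpha>" "piece E ends \<beta>" and un: "\<alpha> \<union> \<beta> = cake E ends"
    and ab: "0 \<le> a" "a \<le> b"
    and \<alpha>: "\<And>n z. n < length L \<Longrightarrow> 0 < z \<Longrightarrow> z < 1 \<Longrightarrow>
      opoint ends (L ! n) z \<in> \<alpha> \<longleftrightarrow> a \<le> real n + z \<and> real n + z \<le> b"
    and \<beta>: "\<And>n z. n < length L \<Longrightarrow> 0 < z \<Longrightarrow> z < 1 \<Longrightarrow>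
      opoint ends (L ! n) z \<in> \<beta> \<Longrightarrow> real n + z \<le> a \<or> b \<le> real n + z"
  shows "division E ends \<alpha> \<beta>" "between_cuts E ends L a b \<alpha>"
proof -
  show "between_cuts E ends L a b \<alpha>"
    unfolding between_cuts_def
  proof (intro ballI impI)
    fix q assume q: "q \<in> cake E ends" "\<forall>v. q \<noteq> Vtx v"
    from L q(1) show "q \<in> \<alpha> \<longleftrightarrow> a \<le> pos L q \<and> pos L q \<le> b"
      by (cases rule: cake_cases) (use q(2) in \<open>auto simp: \<alpha> pos_opoint[OF L]\<close>)
  qed
  have "\<alpha> \<inter> \<beta> \<subseteq> {q \<in> cake E ends. \<exists>v. q = Vtx v} \<union>
      ({q \<in> cake E ends. pos L q = a} \<union> {q \<in> cake E ends. pos L q = b})"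
  proof
    fix q assume q: "q \<in> \<alpha> \<inter> \<beta>"
    then have qc: "q \<in> cake E ends"
      using un by blast
    from L qc show "q \<in> {q \<in> cake E ends. \<exists>v. q = Vtx v} \<union>
      ({q \<in> cake E ends. pos L q = a} \<union> {q \<in> cake E ends. pos L q = b})"
    proof (cases rule: cake_cases)
      case (inner n z)
      have "a \<le> real n + z \<and> real n + z \<le> b" "real n + z \<le> a \<or> b \<le> real n + z"
        using \<alpha>[OF inner(1-3)] \<beta>[OF inner(1-3)] q unfolding inner(4) by auto
      then have "real n + z = a \<or> real n + z = b"
        by linarith
      moreover have "pos L q = real n + z"
        unfolding inner(4) by (rule pos_opoint[OF L inner(1-3)])
      ultimately show ?thesis
        using qc by simp
    qed (use qc in simp)
  qed
  moreover have "finite ({q \<in> cake E ends. \<exists>v. q = Vtx v} \<union>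
      ({q \<in> cake E ends. pos L q = a} \<union> {q \<in> cake E ends. pos L q = b}))"
    using finite_cake_vertices[OF ok] finite_pos_eq[OF L] ab by (intro finite_UnI) auto
  ultimately have "finite (\<alpha> \<inter> \<beta>)"
    by (rule finite_subset)
  then show "division E ends \<alpha> \<beta>"
    unfolding division_def using pieces un by blast
qed

text \<open>With both cuts on one edge the inner piece is a single arc, so only the outer piece,
  which resumes after the gap, receives extra vertices.\<close>

lemma cut_once:
  fixes x y :: real
  assumes ok: "graph_ok V E ends" and L: "edge_list E L" "L = us @ g # vs"
    and A: "finite A" "Vtx ` A \<subseteq> cake E ends"
    and xy: "0 \<le> x" "x \<le> y" "y \<le> 1"
  defines "\<alpha> \<equiv> opoint ends g ` {x..y}"
    and "\<beta> \<equiv> Vtx ` A \<union> opoint ends g ` {y..1} \<union> full ends vs \<union> (full ends us \<union> opoint ends g ` {0..x})"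
  shows "division E ends \<alpha> \<beta>" "between_cuts E ends L (length us + x) (length us + y) \<alpha>"
proof -
  have E: "fst g \<in> E" "fst ` set us \<subseteq> E" "fst ` set vs \<subseteq> E"
    using L unfolding edge_list_def by auto
  have split: "{0..1} = {0..x} \<union> {x..y} \<union> {y..1}"
    using xy by auto
  have "\<alpha> \<union> \<beta> = Vtx ` A \<union> full ends L"
    unfolding \<alpha>_def \<beta>_def L(2) full_simps split image_Un by blast
  then have un: "\<alpha> \<union> \<beta> = cake E ends"
    using A(2) cake_eq_full[OF L(1), of ends] by blast
  have p: "piece E ends \<alpha>" "piece E ends \<beta>"
    unfolding \<alpha>_def \<beta>_def by (intro piece_Un piece_vertices piece_full piece_opoint A E; use xy in simp)+
  have g: "g = L ! length us" "length us < length L"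
    unfolding L(2) by auto
  have mem_g: "opoint ends (L ! n) z \<in> opoint ends g ` I \<longleftrightarrow> n = length us \<and> z \<in> I"
    if "n < length L" "0 < z" "z < 1" "I \<subseteq> {0..1}" for n z I
    unfolding g(1) by (rule inner_mem_opoint[OF L(1) that(1) g(2) that(2-4)])
  have mem_us: "opoint ends (L ! n) z \<in> full ends us \<longleftrightarrow> n < length us"
    if "n < length L" "0 < z" "z < 1" for n z
    using inner_mem_full[of E "[]" us "g # vs" n z ends] L that by simp
  have mem_vs: "opoint ends (L ! n) z \<in> full ends vs \<longleftrightarrow> length us < n"
    if "n < length L" "0 < z" "z < 1" for n z
    using inner_mem_full[of E "us @ [g]" vs "[]" n z ends] L that by auto
  have \<alpha>: "opoint ends (L ! n) z \<in> \<alpha> \<longleftrightarrow> length us + x \<le> real n + z \<and> real n + z \<le> length us + y"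
    if nz: "n < length L" "0 < z" "z < 1" for n z
  proof -
    have "opoint ends (L ! n) z \<in> \<alpha> \<longleftrightarrow> n = length us \<and> x \<le> z \<and> z \<le> y"
      unfolding \<alpha>_def using mem_g[OF nz, of "{x..y}"] xy by simp
    also have "\<dots> \<longleftrightarrow> length us + x \<le> real n + z \<and> real n + z \<le> length us + y"
    proof (cases n "length us" rule: linorder_cases)
      case less
      then have "real n + 1 \<le> real (length us)" by simp
      then show ?thesis using less nz xy by linarith
    next
      case greater
      then have "real (length us) + 1 \<le> real n" by simp
      then show ?thesis using greater nz xy by linarith
    qed auto
    finally show ?thesis .
  qed
  have \<beta>: "real n + z \<le> length us + x \<or> length us + y \<le> real n + z"
    if nz: "n < length L" "0 < z" "z < 1" and "opoint ends (L ! n) z \<in> \<beta>" for n z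
  proof -
    have "n < length us \<or> length us < n \<or> (n = length us \<and> (z \<le> x \<or> y \<le> z))"
      using that(4) mem_g[OF nz, of "{y..1}"] mem_g[OF nz, of "{0..x}"] mem_us[OF nz] mem_vs[OF nz]
        not_inner_Vtx[OF nz(2,3), of ends "L ! n" A] xy unfolding \<beta>_def by auto
    then show ?thesis
    proof (elim disjE conjE)
      assume "n < length us"
      then have "real n + 1 \<le> real (length us)" by simp
      then show ?thesis using nz xy by linarith
    next
      assume "length us < n"
      then have "real (length us) + 1 \<le> real n" by simp
      then show ?thesis using nz xy by linarith
    qed auto
  qed
  show "division E ends \<alpha> \<beta>" "between_cuts E ends L (length us + x) (length us + y) \<alpha>"
    using divisionI[OF ok L(1) p un _ _ \<alpha> \<beta>] xy by auto
qed

text \<open>With cuts on different edges both pieces contain a stretch that starts inside the list: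
  \<open>A\<close> is added for the one starting at \<open>g\<close>, \<open>B\<close> for the one
  resuming at \<open>h\<close>.\<close>

lemma cut_twice:
  fixes x y :: real
  assumes ok: "graph_ok V E ends" and L: "edge_list E L" "L = us @ g # ws @ h # vs"
    and A: "finite A" "Vtx ` A \<subseteq> cake E ends" and B: "finite B" "Vtx ` B \<subseteq> cake E ends"
    and x: "0 \<le> x" "x \<le> 1" and y: "0 \<le> y" "y \<le> 1"
  defines "\<alpha> \<equiv> Vtx ` A \<union> opoint ends g ` {x..1} \<union> full ends ws \<union> opoint ends h ` {0..y}"
    and "\<beta> \<equiv> Vtx ` B \<union> opoint ends h ` {y..1} \<union> full ends vs \<union> (full ends us \<union> opoint ends g ` {0..x})"
    and "l \<equiv> length us + 1 + length ws"
  shows "division E ends \<alpha> \<beta>" "between_cuts E ends L (length us + x) (l + y) \<alpha>"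
proof -
  have E: "fst g \<in> E" "fst h \<in> E" "fst ` set us \<subseteq> E" "fst ` set ws \<subseteq> E" "fst ` set vs \<subseteq> E"
    using L unfolding edge_list_def by auto
  have split: "opoint ends g ` {0..1} = opoint ends g ` {0..x} \<union> opoint ends g ` {x..1}"
     "opoint ends h ` {0..1} = opoint ends h ` {0..y} \<union> opoint ends h ` {y..1}"
    using x y unfolding image_Un[symmetric] by (simp_all add: ivl_disj_un_two_touch)
  have "\<alpha> \<union> \<beta> = Vtx ` A \<union> Vtx ` B \<union> full ends L"
    unfolding \<alpha>_def \<beta>_def L(2) full_simps split by blast
  then have un: "\<alpha> \<union> \<beta> = cake E ends"
    using A(2) B(2) cake_eq_full[OF L(1), of ends] by blast
  have p: "piece E ends \<alpha>" "piece E ends \<beta>"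
    unfolding \<alpha>_def \<beta>_def by (intro piece_Un piece_vertices piece_full piece_opoint A B E; use x y in simp)+
  have g: "g = L ! length us" "length us < length L" and h: "h = L ! l" "l < length L"
    unfolding L(2) l_def by (auto simp: nth_append)
  have mem_g: "opoint ends (L ! n) z \<in> opoint ends g ` I \<longleftrightarrow> n = length us \<and> z \<in> I"
    if "n < length L" "0 < z" "z < 1" "I \<subseteq> {0..1}" for n z I
    unfolding g(1) by (rule inner_mem_opoint[OF L(1) that(1) g(2) that(2-4)])
  have mem_h: "opoint ends (L ! n) z \<in> opoint ends h ` I \<longleftrightarrow> n = l \<and> z \<in> I"
    if "n < length L" "0 < z" "z < 1" "I \<subseteq> {0..1}" for n z I
    unfolding h(1) by (rule inner_mem_opoint[OF L(1) that(1) h(2) that(2-4)])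
  have mem_us: "opoint ends (L ! n) z \<in> full ends us \<longleftrightarrow> n < length us"
    if "n < length L" "0 < z" "z < 1" for n z
    using inner_mem_full[of E "[]" us "g # ws @ h # vs" n z ends] L that by simp
  have mem_ws: "opoint ends (L ! n) z \<in> full ends ws \<longleftrightarrow> length us < n \<and> n < l"
    if "n < length L" "0 < z" "z < 1" for n z
    using inner_mem_full[of E "us @ [g]" ws "h # vs" n z ends] L that unfolding l_def by auto
  have mem_vs: "opoint ends (L ! n) z \<in> full ends vs \<longleftrightarrow> l < n"
    if "n < length L" "0 < z" "z < 1" for n z
    using inner_mem_full[of E "us @ g # ws @ [h]" vs "[]" n z ends] L that unfolding l_def by auto
  have us_l: "real (length us) + 1 \<le> real l"
    unfolding l_def by simp
  have \<alpha>: "opoint ends (L ! n) z \<in> \<alpha> \<longleftrightarrow> length us + x \<le> real n + z \<and> real n + z \<le> l + y"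
    if nz: "n < length L" "0 < z" "z < 1" for n z
  proof -
    have "opoint ends (L ! n) z \<in> \<alpha> \<longleftrightarrow>
        (n = length us \<and> x \<le> z) \<or> (length us < n \<and> n < l) \<or> (n = l \<and> z \<le> y)"
      unfolding \<alpha>_def using mem_g[OF nz, of "{x..1}"] mem_h[OF nz, of "{0..y}"] mem_ws[OF nz]
        not_inner_Vtx[OF nz(2,3), of ends "L ! n" A] nz x y by auto
    also have "\<dots> \<longleftrightarrow> length us + x \<le> real n + z \<and> real n + z \<le> l + y"
    proof -
      consider "n < length us" | "n = length us" | "length us < n" "n < l" | "n = l" | "l < n"
        by linarith
      then show ?thesis
      proof cases
        case 1
        then have "real n + 1 \<le> real (length us)" by simp
        then show ?thesis using 1 nz x us_l by linarith
      next
        case 2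
        then show ?thesis using nz y us_l by auto
      next
        case 3
        then have "real n + 1 \<le> real l" "real (length us) + 1 \<le> real n" by simp_all
        then show ?thesis using 3 nz x y by linarith
      next
        case 4
        then show ?thesis using nz x us_l by auto
      next
        case 5
        then have "real l + 1 \<le> real n" by simp
        then show ?thesis using 5 nz y us_l by linarith
      qed
    qed
    finally show ?thesis .
  qed
  have \<beta>: "real n + z \<le> length us + x \<or> l + y \<le> real n + z"
    if nz: "n < length L" "0 < z" "z < 1" and "opoint ends (L ! n) z \<in> \<beta>" for n z
  proof -
    have "n < length us \<or> l < n \<or> (n = length us \<and> z \<le> x) \<or> (n = l \<and> y \<le> z)"
      using that(4) mem_h[OF nz, of "{y..1}"] mem_g[OF nz, of "{0..x}"] mem_us[OF nz] mem_vs[OF nz]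
        not_inner_Vtx[OF nz(2,3), of ends "L ! n" B] x y unfolding \<beta>_def by auto
    then show ?thesis
    proof (elim disjE conjE)
      assume "n < length us"
      then have "real n + 1 \<le> real (length us)" by simp
      then show ?thesis using nz x by linarith
    next
      assume "l < n"
      then have "real l + 1 \<le> real n" by simp
      then show ?thesis using nz y by linarith
    qed auto
  qed
  have "real (length us) + x \<le> real l + y"
    using us_l x y by linarith
  then show "division E ends \<alpha> \<beta>" "between_cuts E ends L (length us + x) (l + y) \<alpha>"
    using divisionI[OF ok L(1) p un _ _ \<alpha> \<beta>] x by auto
qed

section \<open>Cutting the list of components\<close>

text \<open>Kept symmetric in the two pieces, since they trade places when the arc found has value
  \<open>1 - t\<close> instead of \<open>t\<close>.\<close>

definition few_components :: "'v set \<Rightarrow> 'e set \<Rightarrow> ('e \<Rightarrow> 'v \<times> 'v) \<Rightarrow> nat \<Rightarrow>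
    ('v, 'e) cpt set \<Rightarrow> ('v, 'e) cpt set \<Rightarrow> bool" where
  "few_components V E ends r \<alpha> \<beta> \<longleftrightarrow>
     ncomp E ends \<alpha> + ncomp E ends \<beta> \<le> card (graph_components V E ends) + 2 * r + 4 \<and>
     ((\<exists>i\<in>graph_components V E ends.
         (\<forall>k\<in>graph_components V E ends - {i}. comp_cake E ends k \<subseteq> \<alpha> \<or> comp_cake E ends k \<subseteq> \<beta>) \<and>
         ncomp E ends (\<alpha> \<inter> comp_cake E ends i) \<le> r + 2 \<and>
         ncomp E ends (\<beta> \<inter> comp_cake E ends i) \<le> r + 2) \<or>
      (\<exists>i\<in>graph_components V E ends. \<exists>j\<in>graph_components V E ends. i \<noteq> j \<and>
         (\<forall>k\<in>graph_components V E ends - {i, j}. comp_cake E ends k \<subseteq> \<alpha> \<or> comp_cake E ends k \<subseteq> \<beta>) \<and>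
         ncomp E ends (\<alpha> \<inter> (comp_cake E ends i \<union> comp_cake E ends j)) \<le> r + 3 \<and>
         ncomp E ends (\<beta> \<inter> (comp_cake E ends i \<union> comp_cake E ends j)) \<le> r + 3))"

lemma few_components_commute:
  assumes "few_components V E ends r \<alpha> \<beta>"
  shows "few_components V E ends r \<beta> \<alpha>"
proof -
  let ?G = "graph_components V E ends"
  have sum: "ncomp E ends \<beta> + ncomp E ends \<alpha> \<le> card ?G + 2 * r + 4"
    using assms unfolding few_components_def by linarith
  from assms consider
    i where "i \<in> ?G" "\<forall>k\<in>?G - {i}. comp_cake E ends k \<subseteq> \<alpha> \<or> comp_cake E ends k \<subseteq> \<beta>"
      "ncomp E ends (\<alpha> \<inter> comp_cake E ends i) \<le> r + 2" "ncomp E ends (\<beta> \<inter> comp_cake E ends i) \<le> r + 2"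
  | i j where "i \<in> ?G" "j \<in> ?G" "i \<noteq> j"
      "\<forall>k\<in>?G - {i, j}. comp_cake E ends k \<subseteq> \<alpha> \<or> comp_cake E ends k \<subseteq> \<beta>"
      "ncomp E ends (\<alpha> \<inter> (comp_cake E ends i \<union> comp_cake E ends j)) \<le> r + 3"
      "ncomp E ends (\<beta> \<inter> (comp_cake E ends i \<union> comp_cake E ends j)) \<le> r + 3"
    unfolding few_components_def by (elim conjE disjE bexE)
  then show ?thesis
  proof cases
    case (1 i)
    then have "\<forall>k\<in>?G - {i}. comp_cake E ends k \<subseteq> \<beta> \<or> comp_cake E ends k \<subseteq> \<alpha>"
      by blast
    then show ?thesis
      unfolding few_components_def using sum 1(1,3,4) by (intro conjI disjI1 bexI[of _ i])
  next
    case (2 i j)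
    then have "\<forall>k\<in>?G - {i, j}. comp_cake E ends k \<subseteq> \<beta> \<or> comp_cake E ends k \<subseteq> \<alpha>"
      by blast
    then show ?thesis
      unfolding few_components_def using sum 2(1-3,5,6) by (intro conjI disjI2 bexI[of _ i] bexI[of _ j])
  qed
qed

lemma comp_cake_disjoint:
  assumes ok: "graph_ok V E ends" and C: "C \<in> graph_components V E ends" "D \<in> graph_components V E ends" "C \<noteq> D"
  shows "comp_cake E ends C \<inter> comp_cake E ends D = {}"
proof -
  have CD: "C \<inter> D = {}"
    using graph_components_disjoint[OF ok C] .
  have vtx: "v \<in> X" if X: "X \<in> graph_components V E ends" "Vtx v \<in> comp_cake E ends X" for v X
  proof -
    obtain e x where e: "e \<in> E" "fst (ends e) \<in> X" "Vtx v = edge_pt ends e x"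
      using X(2) unfolding comp_cake_def by blast
    then show ?thesis
      using graph_component_edge_iff[OF ok X(1) e(1)] by (auto simp: edge_pt_def split: if_splits)
  qed
  have inner: "fst (ends e) \<in> X" if "Inner e z \<in> comp_cake E ends X" for e z X
    using that unfolding comp_cake_def by (auto simp: edge_pt_def split: if_splits)
  have "False" if "q \<in> comp_cake E ends C" "q \<in> comp_cake E ends D" for q
  proof (cases q)
    case (Vtx v)
    then show ?thesis
      using vtx[OF C(1)] vtx[OF C(2)] that CD by blast
  next
    case (Inner e z)
    then show ?thesis
      using inner[of e z C] inner[of e z D] that CD by blast
  qed
  then show ?thesis by blast
qed

text \<open>The bookkeeping common to both alternatives: \<open>D\<close> holds the divided
  components, \<open>X\<close> and \<open>Y\<close> their shares. Every undivided component is
  connected and counts 1 in just one of the pieces; it does not meet the components in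
  \<open>D\<close>, so intersecting with those leaves exactly \<open>X\<close> and
  \<open>Y\<close>.\<close>

lemma split_off_components:
  fixes ends :: "'e \<Rightarrow> 'v \<times> 'v"
  assumes ok: "graph_ok V E ends"
    and conn: "\<And>C. C \<in> graph_components V E ends \<Longrightarrow> covered (cake_top E ends) 1 (comp_cake E ends C)"
    and D: "D \<subseteq> graph_components V E ends"
    and X: "X \<subseteq> \<Union>(comp_cake E ends ` D)" "covered (cake_top E ends) n X"
    and Y: "Y \<subseteq> \<Union>(comp_cake E ends ` D)" "covered (cake_top E ends) n Y"
    and parts: "graph_components V E ends - D = Ca \<union> Cb" "Ca \<inter> Cb = {}"
    and \<alpha>: "\<alpha> = X \<union> \<Union>(comp_cake E ends ` Ca)" and \<beta>: "\<beta> = Y \<union> \<Union>(comp_cake E ends ` Cb)"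
  shows "ncomp E ends \<alpha> + ncomp E ends \<beta> \<le> 2 * n + card (graph_components V E ends - D)"
    and "ncomp E ends (\<alpha> \<inter> \<Union>(comp_cake E ends ` D)) \<le> n"
    and "ncomp E ends (\<beta> \<inter> \<Union>(comp_cake E ends ` D)) \<le> n"
    and "\<forall>k\<in>graph_components V E ends - D. comp_cake E ends k \<subseteq> \<alpha> \<or> comp_cake E ends k \<subseteq> \<beta>"
proof -
  have fin: "finite Ca" "finite Cb"
    using finite_graph_components[OF ok] parts(1) by (metis finite_Diff finite_Un)+
  have sub: "Ca \<subseteq> graph_components V E ends" "Cb \<subseteq> graph_components V E ends" "Ca \<inter> D = {}" "Cb \<inter> D = {}"
    using parts(1) by blast+
  have "covered (cake_top E ends) (n + card Ca) \<alpha>"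
    unfolding \<alpha> using sub(1) fin(1) by (intro covered_Un[OF X(2)] covered_UN conn) auto
  moreover have "covered (cake_top E ends) (n + card Cb) \<beta>"
    unfolding \<beta> using sub(2) fin(2) by (intro covered_Un[OF Y(2)] covered_UN conn) auto
  moreover have "card (graph_components V E ends - D) = card Ca + card Cb"
    unfolding parts(1) using fin parts(2) by (rule card_Un_disjoint)
  ultimately show "ncomp E ends \<alpha> + ncomp E ends \<beta> \<le> 2 * n + card (graph_components V E ends - D)"
    using ncomp_le[of E ends "n + card Ca" \<alpha>] ncomp_le[of E ends "n + card Cb" \<beta>] by linarith
  have disj: "\<Union>(comp_cake E ends ` S) \<inter> \<Union>(comp_cake E ends ` D) = {}"
    if "S \<subseteq> graph_components V E ends" "S \<inter> D = {}" for S
  proof -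
    have "comp_cake E ends C \<inter> comp_cake E ends C' = {}" if CC: "C \<in> S" "C' \<in> D" for C C'
      using CC \<open>S \<subseteq> _\<close> \<open>S \<inter> D = {}\<close> D by (intro comp_cake_disjoint[OF ok]) auto
    then show ?thesis by blast
  qed
  have "\<alpha> \<inter> \<Union>(comp_cake E ends ` D) = X"
    unfolding \<alpha> using X(1) disj[OF sub(1,3)] by blast
  then show "ncomp E ends (\<alpha> \<inter> \<Union>(comp_cake E ends ` D)) \<le> n"
    using ncomp_le[OF X(2)] by simp
  have "\<beta> \<inter> \<Union>(comp_cake E ends ` D) = Y"
    unfolding \<beta> using Y(1) disj[OF sub(2,4)] by blast
  then show "ncomp E ends (\<beta> \<inter> \<Union>(comp_cake E ends ` D)) \<le> n"
    using ncomp_le[OF Y(2)] by simp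
  show "\<forall>k\<in>graph_components V E ends - D. comp_cake E ends k \<subseteq> \<alpha> \<or> comp_cake E ends k \<subseteq> \<beta>"
    unfolding parts(1) \<alpha> \<beta> by blast
qed

text \<open>The count is \<open>2 * (r + 2) + (s - 1)\<close> with \<open>s\<close> components in
  all, one below the bound.\<close>

lemma few_components_one:
  assumes ok: "graph_ok V E ends"
    and conn: "\<And>C. C \<in> graph_components V E ends \<Longrightarrow> covered (cake_top E ends) 1 (comp_cake E ends C)"
    and i: "i \<in> graph_components V E ends"
    and X: "X \<subseteq> comp_cake E ends i" "covered (cake_top E ends) (r + 2) X"
    and Y: "Y \<subseteq> comp_cake E ends i" "covered (cake_top E ends) (r + 2) Y"
    and parts: "graph_components V E ends - {i} = Ca \<union> Cb" "Ca \<inter> Cb = {}"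
    and \<alpha>: "\<alpha> = X \<union> \<Union>(comp_cake E ends ` Ca)" and \<beta>: "\<beta> = Y \<union> \<Union>(comp_cake E ends ` Cb)"
  shows "few_components V E ends r \<alpha> \<beta>"
proof -
  have D: "{i} \<subseteq> graph_components V E ends" "\<Union>(comp_cake E ends ` {i}) = comp_cake E ends i"
    using i by simp_all
  note S = split_off_components[OF ok conn D(1) _ X(2) _ Y(2) parts \<alpha> \<beta>, unfolded D(2), OF _ X(1) Y(1)]
  have "card (graph_components V E ends - {i}) \<le> card (graph_components V E ends)"
    using finite_graph_components[OF ok] by (rule card_mono) blast
  then have "ncomp E ends \<alpha> + ncomp E ends \<beta> \<le> card (graph_components V E ends) + 2 * r + 4"
    using S(1) by simp
  then show ?thesis
    unfolding few_components_def using i S(2-4) by blast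
qed

text \<open>Here \<open>2 * (r + 3) + (s - 2)\<close> is exactly \<open>s + 2 * r + 4\<close>; this
  alternative dictates the constant.\<close>

lemma few_components_two:
  assumes ok: "graph_ok V E ends"
    and conn: "\<And>C. C \<in> graph_components V E ends \<Longrightarrow> covered (cake_top E ends) 1 (comp_cake E ends C)"
    and ij: "i \<in> graph_components V E ends" "j \<in> graph_components V E ends" "i \<noteq> j"
    and X: "X \<subseteq> comp_cake E ends i \<union> comp_cake E ends j" "covered (cake_top E ends) (r + 3) X"
    and Y: "Y \<subseteq> comp_cake E ends i \<union> comp_cake E ends j" "covered (cake_top E ends) (r + 3) Y"
    and parts: "graph_components V E ends - {i, j} = Ca \<union> Cb" "Ca \<inter> Cb = {}"
    and \<alpha>: "\<alpha> = X \<union> \<Union>(comp_cake E ends ` Ca)" and \<beta>: "\<beta> = Y \<union> \<Union>(comp_cake E ends ` Cb)"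
  shows "few_components V E ends r \<alpha> \<beta>"
proof -
  have D: "{i, j} \<subseteq> graph_components V E ends"
      "\<Union>(comp_cake E ends ` {i, j}) = comp_cake E ends i \<union> comp_cake E ends j"
    using ij by simp_all
  note S = split_off_components[OF ok conn D(1) _ X(2) _ Y(2) parts \<alpha> \<beta>, unfolded D(2), OF _ X(1) Y(1)]
  have "card (graph_components V E ends - {i, j}) = card (graph_components V E ends) - 2"
    using finite_graph_components[OF ok] ij by (simp add: card_Diff_subset)
  \<comment> \<open>Makes the truncated subtraction of 2 exact.\<close>
  moreover have "2 \<le> card (graph_components V E ends)"
    using card_mono[OF finite_graph_components[OF ok] D(1)] ij(3) by simp
  ultimately have "ncomp E ends \<alpha> + ncomp E ends \<beta> \<le> card (graph_components V E ends) + 2 * r + 4"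
    using S(1) by simp
  then show ?thesis
    unfolding few_components_def using ij S(2-4) by blast
qed

lemma concat_map_split:
  assumes "concat (map f cs) = us @ g # vs"
  obtains cs1 C cs2 us' vs' where "cs = cs1 @ C # cs2" "f C = us' @ g # vs'"
    "us = concat (map f cs1) @ us'" "vs = vs' @ concat (map f cs2)"
  using assms
proof (induction cs arbitrary: us thesis)
  case (Cons C cs)
  consider w where "f C = us @ w" "w @ concat (map f cs) = g # vs"
    | w where "us = f C @ w" "concat (map f cs) = w @ g # vs"
    using Cons.prems(2) by (auto simp: append_eq_append_conv2)
  then show ?case
  proof cases
    case (1 w)
    show ?thesis
    proof (cases w)
      \<comment> \<open>The list of \<open>C\<close> ends just before \<open>g\<close>, so
        \<open>g\<close> belongs to a later component.\<close>
      case Nil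
      then have *: "concat (map f cs) = [] @ g # vs" using 1 by simp
      show ?thesis
      proof (rule Cons.IH[OF _ *])
        fix cs1 D cs2 us' vs' assume D: "cs = cs1 @ D # cs2" "f D = us' @ g # vs'"
          "[] = concat (map f cs1) @ us'" "vs = vs' @ concat (map f cs2)"
        show ?thesis
          by (rule Cons.prems(1)[of "C # cs1" D cs2 us' vs']) (use 1 Nil D in simp_all)
      qed
    next
      case (Cons h w')
      show ?thesis
        by (rule Cons.prems(1)[of "[]" C cs us w']) (use 1 Cons in simp_all)
    qed
  next
    case (2 w)
    show ?thesis
    proof (rule Cons.IH[OF _ 2(2)])
      fix cs1 D cs2 us' vs' assume D: "cs = cs1 @ D # cs2" "f D = us' @ g # vs'"
        "w = concat (map f cs1) @ us'" "vs = vs' @ concat (map f cs2)"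
      show ?thesis
        by (rule Cons.prems(1)[of "C # cs1" D cs2 us' vs']) (use 2 D in simp_all)
    qed
  qed
qed simp

lemma edge_list_concat:
  assumes ok: "graph_ok V E ends" and cs: "distinct cs" "set cs = graph_components V E ends"
    and f: "\<And>C. C \<in> set cs \<Longrightarrow> dfs_order E ends C (cen C) (f C)"
  shows "edge_list E (concat (map f cs))"
proof -
  have fst_f: "fst ` set (f C) = {e\<in>E. fst (ends e) \<in> C}" "distinct (map fst (f C))" if "C \<in> set cs" for C
    using f[OF that] unfolding dfs_order_def by blast+
  have sub: "distinct (map fst (concat (map f ds)))" if "distinct ds" "set ds \<subseteq> set cs" for ds
    using that
  proof (induction ds)
    case (Cons D ds)
    have "fst ` set (f D) \<inter> fst ` set (f D') = {}" if "D' \<in> set ds" for D'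
      using fst_f(1)[of D] fst_f(1)[of D'] graph_components_disjoint[OF ok, of D D'] Cons.prems that cs(2)
      by auto
    then have "fst ` set (f D) \<inter> fst ` set (concat (map f ds)) = {}"
      by auto
    moreover have "distinct (map fst (f D))" "distinct (map fst (concat (map f ds)))"
      using Cons fst_f(2)[of D] by auto
    ultimately show ?case by simp
  qed simp
  have "fst ` set (concat (map f cs)) = (\<Union>C\<in>set cs. fst ` set (f C))"
    by auto
  also have "\<dots> = {e\<in>E. fst (ends e) \<in> \<Union>(graph_components V E ends)}"
    unfolding cs(2)[symmetric] using fst_f(1) by auto
  also have "\<dots> = E"
    using ok unfolding Union_graph_components[OF ok] graph_ok_def by blast
  finally show ?thesis
    unfolding edge_list_def using sub[OF cs(1)] by simp
qed

text \<open>The right end of the segment is read as the end point of the last edge; any other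
  integer position becomes the start of an edge.\<close>

lemma segment_position:
  fixes a :: real
  assumes "0 \<le> a" "a \<le> real n" "0 < n"
  obtains k x where "k < n" "0 \<le> x" "x \<le> 1" "a = real k + x"
proof (cases "a = n")
  case True
  then show thesis
    using that[of "n - 1" 1] assms(3) by (simp add: of_nat_diff)
next
  case False
  then have "nat \<lfloor>a\<rfloor> < n" "real (nat \<lfloor>a\<rfloor>) \<le> a" "a \<le> real (nat \<lfloor>a\<rfloor>) + 1"
    using assms by linarith+
  then show thesis
    by (intro that[of "nat \<lfloor>a\<rfloor>" "a - real (nat \<lfloor>a\<rfloor>)"]) linarith+
qed

lemma segment_positions:
  fixes a b :: real
  assumes "0 \<le> a" "a \<le> b" "b \<le> real n" "0 < n"
  obtains k x l y where "k < n" "l < n" "0 \<le> x" "x \<le> 1" "0 \<le> y" "y \<le> 1"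
    "a = real k + x" "b = real l + y" "k < l \<or> (k = l \<and> x \<le> y)"
proof -
  obtain k x where k: "k < n" "0 \<le> x" "x \<le> 1" "a = real k + x"
    using segment_position[OF assms(1) order_trans[OF assms(2,3)] assms(4)] by blast
  obtain l y where l: "l < n" "0 \<le> y" "y \<le> 1" "b = real l + y"
    using segment_position[OF order_trans[OF assms(1,2)] assms(3,4)] by blast
  consider "k < l" | "k = l" | "l < k" by linarith
  then show thesis
  proof cases
    \<comment> \<open>Possible only if \<open>a = b\<close> is a junction of two consecutive edges;
      both cuts are then placed on the edge found for \<open>a\<close>.\<close>
    case 3
    then have "real l + 1 \<le> real k" by simp
    then have "b = real k + x"
      using k l assms(2) by linarith
    then show thesis
      using that[of k k x x] k by simp
  qed (use that[of k l x y] k l assms(2) in auto)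
qed

text \<open>The cuts may fall on one edge, on two edges of one component, or into two components;
  only the last situation leads to the second alternative of the theorem.\<close>

lemma cut_division:
  fixes V :: "'v set" and E :: "'e set" and f :: "'v set \<Rightarrow> ('e \<times> bool) list" and ends :: "'e \<Rightarrow> 'v \<times> 'v"
  defines "G \<equiv> graph_components V E ends"
  assumes ok: "graph_ok V E ends" and E: "E \<noteq> {}"
    and cs: "distinct cs" "set cs = G"
    and f: "\<And>C. C \<in> G \<Longrightarrow> dfs_order E ends C (cen C) (f C)"
    and r: "\<And>C. C \<in> G \<Longrightarrow> comp_radius E ends C \<le> r"
    and L: "L = concat (map f cs)"
    and ab: "0 \<le> a" "a \<le> b" "b \<le> real (length L)"
  shows "\<exists>\<alpha> \<beta>. division E ends \<alpha> \<beta> \<and> few_components V E ends r \<alpha> \<beta> \<and> between_cuts E ends L a b \<alpha>"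
proof -
  have EL: "edge_list E L"
    unfolding L using edge_list_concat[OF ok cs[unfolded G_def] f] cs(2) by blast
  then have "0 < length L"
    using E unfolding edge_list_def by auto
  then obtain k x l y where kl: "k < length L" "l < length L" and x: "0 \<le> x" "x \<le> 1" and y: "0 \<le> y" "y \<le> 1"
    and ab_eq: "a = real k + x" "b = real l + y" and order: "k < l \<or> (k = l \<and> x \<le> y)"
    using segment_positions[OF ab] by metis
  have conn: "covered (cake_top E ends) 1 (comp_cake E ends C)" if "C \<in> graph_components V E ends" for C
    using comp_cake_connected[OF f] that unfolding G_def by blast
  have full: "comp_cake E ends C = full ends (f C)" if "C \<in> G" for C
    using comp_cake_full[OF f[OF that]] .
  have fulls: "full ends (concat (map f ds)) = \<Union>(comp_cake E ends ` set ds)" if "set ds \<subseteq> G" for ds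
    using full that by auto
  have dfs: "reach ends {cen C} (f C)" "fst ` set (f C) \<subseteq> E" if "C \<in> G" for C
    using f[OF that] unfolding dfs_order_def by auto
  have in_cake: "comp_cake E ends C \<subseteq> cake E ends" for C
    unfolding comp_cake_def cake_def by blast
  define us g vs where "us = take k L" and "g = L ! k" and "vs = drop (Suc k) L"
  have split: "L = us @ g # vs" and len: "length us = k"
    unfolding us_def g_def vs_def using kl(1) by (auto simp: id_take_nth_drop)
  obtain cs1 C cs2 us' vs' where C: "cs = cs1 @ C # cs2" "f C = us' @ g # vs'"
      "us = concat (map f cs1) @ us'" "vs = vs' @ concat (map f cs2)"
    using concat_map_split[OF split[unfolded L]] .
  have CG: "C \<in> G" "set cs1 \<subseteq> G" "set cs2 \<subseteq> G" "C \<notin> set cs1" "C \<notin> set cs2" "set cs1 \<inter> set cs2 = {}"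
    using cs unfolding C(1) by auto
  have rest: "G - {C} = set cs1 \<union> set cs2"
    using CG unfolding cs(2)[symmetric] C(1) by auto
  have E': "fst ` set us' \<subseteq> E" "fst ` set vs' \<subseteq> E" "fst g \<in> E"
    using dfs(2)[OF CG(1)] unfolding C(2) by auto
  obtain A where A: "finite A" "Vtx ` A \<subseteq> comp_cake E ends C"
    and A_suffix: "\<forall>x. 0 \<le> x \<longrightarrow> x \<le> 1 \<longrightarrow>
      covered (cake_top E ends) (comp_radius E ends C + 2) (Vtx ` A \<union> opoint ends g ` {x..1} \<union> full ends vs')"
    and A_middle: "\<forall>ws h zs x y. vs' = ws @ h # zs \<longrightarrow> 0 \<le> x \<longrightarrow> x \<le> 1 \<longrightarrow> 0 \<le> y \<longrightarrow> y \<le> 1 \<longrightarrow>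
      covered (cake_top E ends) (comp_radius E ends C + 2)
        (Vtx ` A \<union> opoint ends g ` {x..1} \<union> full ends ws \<union> opoint ends h ` {0..y})"
    and A_outer: "\<forall>x Q. 0 \<le> x \<longrightarrow> x \<le> 1 \<longrightarrow> covered (cake_top E ends) 1 Q \<longrightarrow> Vtx (cen C) \<in> Q \<longrightarrow>
      covered (cake_top E ends) (comp_radius E ends C + 2) (Vtx ` A \<union> opoint ends g ` {x..1} \<union> full ends vs' \<union> Q)"
    using cut_component[OF f[OF CG(1), unfolded C(2)]] by (elim exE conjE)
  have rC: "comp_radius E ends C + 2 \<le> r + 2"
    using r[OF CG(1)] by simp
  note prefix = prefix_connected[OF dfs(1)[OF CG(1), unfolded C(2)] E'(1,3) x]
  have sub_C: "opoint ends g ` {u..v} \<subseteq> comp_cake E ends C" if "0 \<le> u" "v \<le> 1" for u v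
  proof -
    have "{u..v} \<subseteq> {0..1}" using that by auto
    then have "opoint ends g ` {u..v} \<subseteq> opoint ends g ` {0..1}" by (rule image_mono)
    then show ?thesis
      unfolding full[OF CG(1)] C(2) full_simps by blast
  qed
  have sub_C': "full ends us' \<subseteq> comp_cake E ends C" "full ends vs' \<subseteq> comp_cake E ends C"
    unfolding full[OF CG(1)] C(2) full_simps by blast+
  from order show ?thesis
  proof
    assume kl': "k = l \<and> x \<le> y"
    define \<alpha> where "\<alpha> = opoint ends g ` {x..y}"
    define \<beta> where "\<beta> = Vtx ` A \<union> opoint ends g ` {y..1} \<union> full ends vs \<union> (full ends us \<union> opoint ends g ` {0..x})"
    \<comment> \<open>The share of \<open>\<beta>\<close> in the component \<open>C\<close>; it
      differs from \<open>\<beta>\<close> only by whole components before and after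
      \<open>C\<close>.\<close>
    define Y where "Y = Vtx ` A \<union> opoint ends g ` {y..1} \<union> full ends vs' \<union> (full ends us' \<union> opoint ends g ` {0..x})"
    have "division E ends \<alpha> \<beta>" "between_cuts E ends L a b \<alpha>"
      using cut_once[OF ok EL split A(1) _ x(1) _ y(2)] A(2) in_cake kl' unfolding \<alpha>_def \<beta>_def ab_eq len by blast+
    moreover have "few_components V E ends r \<alpha> \<beta>"
    proof (rule few_components_one[OF ok conn CG(1)[unfolded G_def]])
      show "covered (cake_top E ends) (r + 2) \<alpha>"
        unfolding \<alpha>_def
        by (rule covered_mono[OF covered_path_connectedin[OF path_connectedin_opoint]]) (use E' x y in auto)
      show "covered (cake_top E ends) (r + 2) Y"
        unfolding Y_def by (rule covered_mono[OF A_outer[rule_format, OF y prefix] rC])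
      show "\<alpha> \<subseteq> comp_cake E ends C"
        unfolding \<alpha>_def by (rule sub_C[OF x(1) y(2)])
      show "Y \<subseteq> comp_cake E ends C"
        unfolding Y_def by (intro Un_least A sub_C sub_C' x y order_refl)
      show "graph_components V E ends - {C} = {} \<union> (set cs1 \<union> set cs2)"
        using rest unfolding G_def by simp
      show "\<alpha> = \<alpha> \<union> \<Union>(comp_cake E ends ` {})" "{} \<inter> (set cs1 \<union> set cs2) = {}"
        by simp_all
      show "\<beta> = Y \<union> \<Union>(comp_cake E ends ` (set cs1 \<union> set cs2))"
        unfolding \<beta>_def Y_def C(3,4) full_simps(3) fulls[OF CG(2)] fulls[OF CG(3)] by blast
    qed
    ultimately show ?thesis
      by blast
  next
    assume kl': "k < l"
    define ws h zs where "ws = take (l - Suc k) vs" and "h = L ! l" and "zs = drop (l - k) vs"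
    have "l - Suc k < length vs" "h = vs ! (l - Suc k)" "Suc (l - Suc k) = l - k"
      using kl' kl(2) unfolding vs_def h_def by auto
    then have split_vs: "vs = ws @ h # zs"
      unfolding ws_def zs_def by (metis id_take_nth_drop)
    have len_l: "k + 1 + length ws = l"
      unfolding ws_def vs_def using kl' kl(2) by simp
    have split2: "L = us @ g # ws @ h # zs"
      using split split_vs by simp
    have step: "\<exists>\<alpha> \<beta>. division E ends \<alpha> \<beta> \<and> few_components V E ends r \<alpha> \<beta> \<and> between_cuts E ends L a b \<alpha>"
      if B: "finite B" "Vtx ` B \<subseteq> cake E ends" and
        few: "few_components V E ends r
          (Vtx ` A \<union> opoint ends g ` {x..1} \<union> full ends ws \<union> opoint ends h ` {0..y})
          (Vtx ` B \<union> opoint ends h ` {y..1} \<union> full ends zs \<union> (full ends us \<union> opoint ends g ` {0..x}))" for B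
      using cut_twice[OF ok EL split2 A(1) subset_trans[OF A(2) in_cake] B x y] few
      unfolding len len_l ab_eq by blast
    \<comment> \<open>Decides whether the second cut still lies in the list of \<open>C\<close>. If
      that list ends right before \<open>h\<close>, the second case applies with \<open>w\<close>
      empty.\<close>
    consider (same) us2 where "vs' = ws @ h # us2" "zs = us2 @ concat (map f cs2)"
      | (later) w where "ws = vs' @ w" "concat (map f cs2) = w @ h # zs"
    proof -
      have "ws @ h # zs = vs' @ concat (map f cs2)"
        using split_vs C(4) by simp
      then consider w where "ws = vs' @ w" "w @ h # zs = concat (map f cs2)"
        | w where "ws @ w = vs'" "h # zs = w @ concat (map f cs2)"
        by (auto simp: append_eq_append_conv2)
      then show thesis
      proof cases
        case (2 w)
        show thesis
        proof (cases w)
          case Nil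
          then show thesis using later[of "[]"] 2 by simp
        next
          case (Cons h' w')
          then show thesis using same[of w'] 2 by simp
        qed
      qed (use later in simp)
    qed
    then show ?thesis
    proof cases
      case same
      have dfs_h: "dfs_order E ends C (cen C) ((us' @ g # ws) @ h # us2)"
        using f[OF CG(1)] unfolding C(2) same(1) by simp
      obtain B where B: "finite B" "Vtx ` B \<subseteq> comp_cake E ends C"
        and B_outer: "\<forall>x Q. 0 \<le> x \<longrightarrow> x \<le> 1 \<longrightarrow> covered (cake_top E ends) 1 Q \<longrightarrow> Vtx (cen C) \<in> Q \<longrightarrow>
          covered (cake_top E ends) (comp_radius E ends C + 2) (Vtx ` B \<union> opoint ends h ` {x..1} \<union> full ends us2 \<union> Q)"
        using cut_component[OF dfs_h] by (elim exE conjE)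
      have sub_h: "opoint ends h ` {u..v} \<subseteq> comp_cake E ends C" if "0 \<le> u" "v \<le> 1" for u v
      proof -
        have "{u..v} \<subseteq> {0..1}" using that by auto
        then have "opoint ends h ` {u..v} \<subseteq> opoint ends h ` {0..1}" by (rule image_mono)
        then show ?thesis
          unfolding full[OF CG(1)] C(2) same(1) full_simps by blast
      qed
      have sub_ws: "full ends ws \<subseteq> comp_cake E ends C" "full ends us2 \<subseteq> comp_cake E ends C"
        unfolding full[OF CG(1)] C(2) same(1) full_simps by blast+
      define X where "X = Vtx ` A \<union> opoint ends g ` {x..1} \<union> full ends ws \<union> opoint ends h ` {0..y}"
      define Y where "Y = Vtx ` B \<union> opoint ends h ` {y..1} \<union> full ends us2 \<union> (full ends us' \<union> opoint ends g ` {0..x})"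
      show ?thesis
      proof (rule step[OF B(1) subset_trans[OF B(2) in_cake]],
          rule few_components_one[OF ok conn CG(1)[unfolded G_def]])
        show "covered (cake_top E ends) (r + 2) X"
          unfolding X_def by (rule covered_mono[OF A_middle[rule_format, OF same(1) x y] rC])
        show "covered (cake_top E ends) (r + 2) Y"
          unfolding Y_def by (rule covered_mono[OF B_outer[rule_format, OF y prefix] rC])
        show "X \<subseteq> comp_cake E ends C"
          unfolding X_def by (intro Un_least A sub_C sub_h sub_ws x y order_refl)
        show "Y \<subseteq> comp_cake E ends C"
          unfolding Y_def by (intro Un_least B sub_C sub_C' sub_h sub_ws x y order_refl)
        show "graph_components V E ends - {C} = {} \<union> (set cs1 \<union> set cs2)"
          using rest unfolding G_def by simp
        show "{} \<inter> (set cs1 \<union> set cs2) = {}"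
          "Vtx ` A \<union> opoint ends g ` {x..1} \<union> full ends ws \<union> opoint ends h ` {0..y} = X \<union> \<Union>(comp_cake E ends ` {})"
          unfolding X_def by simp_all
        show "Vtx ` B \<union> opoint ends h ` {y..1} \<union> full ends zs \<union> (full ends us \<union> opoint ends g ` {0..x}) =
            Y \<union> \<Union>(comp_cake E ends ` (set cs1 \<union> set cs2))"
          unfolding Y_def C(3) same(2) full_simps(3) fulls[OF CG(2)] fulls[OF CG(3)] by blast
      qed
    next
      case later
      obtain cs3 D cs4 us2 vs2 where D: "cs2 = cs3 @ D # cs4" "f D = us2 @ h # vs2"
          "w = concat (map f cs3) @ us2" "zs = vs2 @ concat (map f cs4)"
        using concat_map_split[OF later(2)] .
      have DG: "D \<in> G" "set cs3 \<subseteq> G" "set cs4 \<subseteq> G" "C \<noteq> D"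
        using CG unfolding D(1) by auto
      \<comment> \<open>Components strictly between the two cuts go to the arc, all other undivided
        ones to its complement.\<close>
      have rest2: "G - {C, D} = set cs3 \<union> (set cs1 \<union> set cs4)" "set cs3 \<inter> (set cs1 \<union> set cs4) = {}"
        using cs unfolding C(1) D(1) by auto
      have E2: "fst ` set us2 \<subseteq> E" "fst h \<in> E"
        using dfs(2)[OF DG(1)] unfolding D(2) by auto
      obtain B where B: "finite B" "Vtx ` B \<subseteq> comp_cake E ends D"
        and B_suffix: "\<forall>x. 0 \<le> x \<longrightarrow> x \<le> 1 \<longrightarrow>
          covered (cake_top E ends) (comp_radius E ends D + 2) (Vtx ` B \<union> opoint ends h ` {x..1} \<union> full ends vs2)"
        using cut_component[OF f[OF DG(1), unfolded D(2)]] by (elim exE conjE)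
      have sub_h: "opoint ends h ` {u..v} \<subseteq> comp_cake E ends D" if "0 \<le> u" "v \<le> 1" for u v
      proof -
        have "{u..v} \<subseteq> {0..1}" using that by auto
        then have "opoint ends h ` {u..v} \<subseteq> opoint ends h ` {0..1}" by (rule image_mono)
        then show ?thesis
          unfolding full[OF DG(1)] D(2) full_simps by blast
      qed
      have sub_D: "full ends us2 \<subseteq> comp_cake E ends D" "full ends vs2 \<subseteq> comp_cake E ends D"
        unfolding full[OF DG(1)] D(2) full_simps by blast+
      \<comment> \<open>Each share joins a suffix of one component with a prefix of the other.
        Nothing connects them, so their bounds \<open>r + 2\<close> and 1 are simply added.\<close>
      define X where "X = (Vtx ` A \<union> opoint ends g ` {x..1} \<union> full ends vs') \<union> (full ends us2 \<union> opoint ends h ` {0..y})"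
      define Y where "Y = (Vtx ` B \<union> opoint ends h ` {y..1} \<union> full ends vs2) \<union> (full ends us' \<union> opoint ends g ` {0..x})"
      show ?thesis
      proof (rule step[OF B(1) subset_trans[OF B(2) in_cake]],
          rule few_components_two[OF ok conn CG(1)[unfolded G_def] DG(1)[unfolded G_def] DG(4)])
        show "covered (cake_top E ends) (r + 3) X"
          unfolding X_def
          by (rule covered_mono[OF covered_Un[OF A_suffix[rule_format, OF x]
                prefix_connected(1)[OF dfs(1)[OF DG(1), unfolded D(2)] E2 y]]])
            (use r[OF CG(1)] in simp)
        show "covered (cake_top E ends) (r + 3) Y"
          unfolding Y_def
          by (rule covered_mono[OF covered_Un[OF B_suffix[rule_format, OF y] prefix(1)]]) (use r[OF DG(1)] in simp)
        have "Vtx ` A \<union> opoint ends g ` {x..1} \<union> full ends vs' \<subseteq> comp_cake E ends C"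
          "full ends us2 \<union> opoint ends h ` {0..y} \<subseteq> comp_cake E ends D"
          by (intro Un_least A sub_C sub_C' sub_h sub_D x y order_refl)+
        then show "X \<subseteq> comp_cake E ends C \<union> comp_cake E ends D"
          unfolding X_def by blast
        have "Vtx ` B \<union> opoint ends h ` {y..1} \<union> full ends vs2 \<subseteq> comp_cake E ends D"
          "full ends us' \<union> opoint ends g ` {0..x} \<subseteq> comp_cake E ends C"
          by (intro Un_least B sub_C sub_C' sub_h sub_D x y order_refl)+
        then show "Y \<subseteq> comp_cake E ends C \<union> comp_cake E ends D"
          unfolding Y_def by blast
        show "graph_components V E ends - {C, D} = set cs3 \<union> (set cs1 \<union> set cs4)"
          using rest2(1) unfolding G_def .
        show "set cs3 \<inter> (set cs1 \<union> set cs4) = {}"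
          by (rule rest2(2))
        show "Vtx ` A \<union> opoint ends g ` {x..1} \<union> full ends ws \<union> opoint ends h ` {0..y} =
            X \<union> \<Union>(comp_cake E ends ` set cs3)"
          unfolding X_def later(1) D(3) full_simps(3) fulls[OF DG(2)] by blast
        show "Vtx ` B \<union> opoint ends h ` {y..1} \<union> full ends zs \<union> (full ends us \<union> opoint ends g ` {0..x}) =
            Y \<union> \<Union>(comp_cake E ends ` (set cs1 \<union> set cs4))"
          unfolding Y_def C(3) D(4) full_simps(3) fulls[OF CG(2)] fulls[OF DG(3)] by blast
      qed
    qed
  qed
qed

theorem mainTheorem6:
  fixes V :: "'v set" and E :: "'e set" and ends :: "'e \<Rightarrow> 'v \<times> 'v"
    and vA vB :: "('v, 'e) cpt measure" and t :: real
  assumes "graph_ok V E ends"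
    and "valuation E ends vA" and "valuation E ends vB"
    and "0 \<le> t" and "t \<le> 1"
  defines "comps \<equiv> graph_components V E ends"
  defines "s \<equiv> card comps"
  defines "r \<equiv> Max (comp_radius E ends ` comps)"
  shows "\<exists>\<alpha> \<beta>. division E ends \<alpha> \<beta> \<and> weighted_consensus vA vB t \<alpha> \<beta> \<and>
           ncomp E ends \<alpha> + ncomp E ends \<beta> \<le> s + 2 * r + 4 \<and>
           ((\<exists>i\<in>comps.
               (\<forall>k\<in>comps - {i}. comp_cake E ends k \<subseteq> \<alpha> \<or> comp_cake E ends k \<subseteq> \<beta>) \<and>
               ncomp E ends (\<alpha> \<inter> comp_cake E ends i) \<le> r + 2 \<and>
               ncomp E ends (\<beta> \<inter> comp_cake E ends i) \<le> r + 2) \<or>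
            (\<exists>i\<in>comps. \<exists>j\<in>comps. i \<noteq> j \<and>
               (\<forall>k\<in>comps - {i, j}. comp_cake E ends k \<subseteq> \<alpha> \<or> comp_cake E ends k \<subseteq> \<beta>) \<and>
               ncomp E ends (\<alpha> \<inter> (comp_cake E ends i \<union> comp_cake E ends j)) \<le> r + 3 \<and>
               ncomp E ends (\<beta> \<inter> (comp_cake E ends i \<union> comp_cake E ends j)) \<le> r + 3))"
proof -
  have ok: "graph_ok V E ends"
    by fact
  have "prob_space vA" "space vA = cake E ends"
    using assms(2) unfolding valuation_def by blast+
  \<comment> \<open>A probability space is not empty, so the cake has a point and therefore an edge
    on which the cuts can be placed.\<close>
  then have E: "E \<noteq> {}"
    using prob_space.not_empty[of vA] unfolding cake_def by auto
  have fin: "finite comps"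
    unfolding comps_def by (rule finite_graph_components[OF ok])
  then obtain cs where cs: "set cs = comps" "distinct cs"
    using finite_distinct_list by blast
  have "\<forall>C\<in>comps. \<exists>gs c. dfs_order E ends C c gs"
    unfolding comps_def using dfs_order_exists[OF ok] by blast
  then obtain f where "\<forall>C\<in>comps. \<exists>c. dfs_order E ends C c (f C)"
    by (rule bchoice[THEN exE])
  then obtain cen where f: "\<forall>C\<in>comps. dfs_order E ends C (cen C) (f C)"
    by (rule bchoice[THEN exE])
  have r: "comp_radius E ends C \<le> r" if "C \<in> comps" for C
    unfolding r_def using fin that by (intro Max_ge) auto
  define L where "L = concat (map f cs)"
  have L: "edge_list E L"
    unfolding L_def
    by (rule edge_list_concat[OF ok cs(2) cs(1)[unfolded comps_def], where cen = cen]) (use f cs(1) in blast)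
  obtain a b where ab: "0 \<le> a" "a \<le> b" "b \<le> real (length L)"
    and cut: "(pos_cdf L vA b - pos_cdf L vA a = t \<and> pos_cdf L vB b - pos_cdf L vB a = t) \<or>
      (pos_cdf L vA b - pos_cdf L vA a = 1 - t \<and> pos_cdf L vB b - pos_cdf L vB a = 1 - t)"
    using common_interval[of "real (length L)" "pos_cdf L vA" "pos_cdf L vB" t,
        OF _ continuous_pos_cdf[OF assms(2) L] continuous_pos_cdf[OF assms(3) L]
        mono_pos_cdf[OF assms(2) L] mono_pos_cdf[OF assms(3) L]
        pos_cdf_0[OF ok assms(2) L] pos_cdf_0[OF ok assms(3) L]
        pos_cdf_length[OF assms(2) L] pos_cdf_length[OF assms(3) L] assms(4,5)] by auto
  obtain \<alpha> \<beta> where division: "division E ends \<alpha> \<beta>" and few: "few_components V E ends r \<alpha> \<beta>"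
    and between: "between_cuts E ends L a b \<alpha>"
    using cut_division[OF ok E cs(2) cs(1)[unfolded comps_def] _ _ L_def ab, of cen r] f r
    unfolding comps_def by blast
  have un: "\<alpha> \<union> \<beta> = cake E ends" and fin_int: "finite (\<alpha> \<inter> \<beta>)"
    using division unfolding division_def by blast+
  have measures: "measure M \<alpha> = pos_cdf L M b - pos_cdf L M a" "measure M \<beta> = 1 - measure M \<alpha>"
    if M: "valuation E ends M" for M
  proof -
    interpret prob_space M
      using M unfolding valuation_def by blast
    have sp: "space M = cake E ends"
      using M unfolding valuation_def by blast
    have \<alpha>: "\<alpha> \<subseteq> cake E ends"
      using un by blast
    have inner: "q \<in> \<alpha> \<longleftrightarrow> a \<le> pos L q \<and> pos L q \<le> b" if "q \<in> cake E ends" "\<forall>v. q \<noteq> Vtx v" for q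
      using between that unfolding between_cuts_def by blast
    note \<alpha>_measure = measure_between_cuts[OF ok M L ab(1,2) \<alpha> inner]
    show "measure M \<alpha> = pos_cdf L M b - pos_cdf L M a"
      by (rule \<alpha>_measure(2))
    \<comment> \<open>\<open>\<beta>\<close> exceeds the complement of \<open>\<alpha>\<close> only
      by the finite overlap, so its value is the complementary one.\<close>
    have "\<beta> - (space M - \<alpha>) = \<alpha> \<inter> \<beta>" and diff: "(space M - \<alpha>) - \<beta> = {}"
      unfolding sp using un by blast+
    then have fins: "finite (\<beta> - (space M - \<alpha>))" "finite ((space M - \<alpha>) - \<beta>)"
      using fin_int by (simp_all only: finite.emptyI)
    have "\<beta> \<subseteq> cake E ends"
      using un by blast
    from measure_eq_finite_diff(2)[OF M sets.compl_sets[OF \<alpha>_measure(1)] this fins]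
    have "measure M \<beta> = measure M (space M - \<alpha>)" .
    then show "measure M \<beta> = 1 - measure M \<alpha>"
      using prob_compl[OF \<alpha>_measure(1)] by simp
  qed
  have division': "division E ends \<beta> \<alpha>"
    using division unfolding division_def by (auto simp: Un_commute Int_commute)
  from cut have "\<exists>\<alpha> \<beta>. division E ends \<alpha> \<beta> \<and> weighted_consensus vA vB t \<alpha> \<beta> \<and> few_components V E ends r \<alpha> \<beta>"
  proof
    assume "pos_cdf L vA b - pos_cdf L vA a = t \<and> pos_cdf L vB b - pos_cdf L vB a = t"
    then have "weighted_consensus vA vB t \<alpha> \<beta>"
      unfolding weighted_consensus_def using measures[OF assms(2)] measures[OF assms(3)] by simp
    then show ?thesis
      using division few by blast
  next
    \<comment> \<open>The arc carries the complementary share, so the roles of the two pieces are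
      exchanged.\<close>
    assume "pos_cdf L vA b - pos_cdf L vA a = 1 - t \<and> pos_cdf L vB b - pos_cdf L vB a = 1 - t"
    then have "weighted_consensus vA vB t \<beta> \<alpha>"
      unfolding weighted_consensus_def using measures[OF assms(2)] measures[OF assms(3)] by simp
    then show ?thesis
      using division' few_components_commute[OF few] by blast
  qed
  then show ?thesis
    unfolding few_components_def comps_def s_def .
qed

end
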